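(* Assume the standing assumption on $(h,F,T,\psi,\vartheta)$ stated in the context, let $\nu>0$, $\lambda>0$, and let $\{x^k\}_{k\in\mathbb{N}}$ be an infinite sequence generated by Algorithm iPMM (described in the context), with associated scalars $\gamma_k:=\gamma_{k,j_k}$ and parameter $\varrho>1$. Suppose that $\{x^k\}_{k\in\mathbb{N}}$ is bounded and that $F$ and $T$ are twice continuously differentiable on the open set $\mathcal{O}$. Let $\widetilde\gamma>0$ be a constant such that $\gamma_k\le\widetilde\gamma$ for all $k\in\mathbb{N}$ (boundedness of $\{x^k\}_{k\in\mathbb{N}}$ ensures that such a constant exists), put $\widehat\gamma:=2\varrho\widetilde\gamma$ and $$\Xi(x,z,t):=\vartheta(|\ell_F(x;z)|)+\nu\psi(\ell_T(x;z))+\lambda h(x)+\frac{\widehat\gamma}{2}\|x-z\|_{\mathbb{X}}^2+t^2 .$$ If $\Xi$ is a KL function, then $\sum_{k=1}^{\infty}\|x^{k+1}-x^k\|_{\mathbb{X}}<\infty$, and hence $\{x^k\}_{k\in\mathbb{N}}$ is convergent with limit $x^*\in\mathcal{S}^*$, where $\mathcal{S}^*$ is the set of stationary points of $\min_{x\in\mathbb{X}}\Theta(x)$.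
   Context: **Problem.** $\mathbb{X}$ is a finite-dimensional real inner product space with inner product $\langle\cdot,\cdot\rangle$ and induced norm $\|\cdot\|_{\mathbb{X}}$; matrix spaces carry the trace inner product and the Frobenius norm $\|\cdot\|_F$. For a matrix $y$, $|y|$ is the matrix with entries $|y_{ij}|$. The problem is $$\min_{x\in\mathbb{X}}\Theta(x):=\vartheta(|F(x)|)+\nu\psi(T(x))+\lambda h(x).$$ **Standing assumption.** (i) $h:\mathbb{X}\to(-\infty,\infty]$ is proper, lower semicontinuous (lsc), convex, bounded below, and strictly continuous (i.e. locally Lipschitz) relative to its domain $\mathrm{dom}\,h$. (ii) $F:\mathcal{O}\to\mathbb{R}^{m\times n}$ and $T:\mathcal{O}\to\mathbb{R}^{p\times q}$ are continuously differentiable on an open set $\mathcal{O}\supset\mathrm{dom}\,h$. (iii) $\psi:\mathbb{R}^{p\times q}\to\mathbb{R}$ is convex and bounded below, and $\vartheta(z)=\sum_{i,j}\theta(z_{ij})$, where $\theta$ is a concave function which is differentiable on an open interval $I\supset\mathbb{R}_+=[0,\infty)$ with locally Lipschitz derivative $\theta'$, and satisfies $\theta'(t)\ge0$ for all $t\ge0$ and $\theta(0)=0$. ($\vartheta$ is considered on matrices with entries in $I$; $\nabla\vartheta(z)$ is the matrix with entries $\theta'(z_{ij})$.) $\Theta(x)=\infty$ for $x\notin\mathrm{dom}\,h$. **Notation.** $F'(x)$ is the derivative of $F$ at $x$ and $\nabla F(x)$ is the adjoint of $F'(x)$; similarly for $T$. $\ell_F(x;z):=F(z)+F'(z)(x-z)$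 and $\ell_T(x;z):=T(z)+T'(z)(x-z)$ for $x\in\mathbb{X}$, $z\in\mathcal{O}$. For a positive definite (PD, self-adjoint) linear operator $\mathcal{Q}$ on $\mathbb{X}$, $\|x\|_{\mathcal{Q}}:=\sqrt{\langle x,\mathcal{Q}x\rangle}$; $\mathcal{I}$ is the identity and $\preceq$ the Loewner order. $\partial$ is the limiting (Mordukhovich) subdifferential, which is the usual subdifferential for convex functions. For $y\in\mathbb{R}^{m\times n}$, $y\circ\partial|F(x)|:=\{v\in\mathbb{R}^{m\times n}: v_{ij}\in y_{ij}\,\partial|[F(x)]_{ij}|\}$, with $\partial|s|=\{\mathrm{sign}(s)\}$ if $s\neq0$ and $\partial|0|=[-1,1]$. **Stationary point.** $x\in\mathrm{dom}\,h$ is stationary if $0\in\nabla F(x)[\nabla\vartheta(|F(x)|)\circ\partial|F(x)|]+\nu\nabla T(x)\partial\psi(T(x))+\lambda\partial h(x)$. **Algorithm iPMM.** Parameters: $\varrho>1$, $0<\underline\gamma<\overline\gamma$, $\overline\mu>0$, $\{\mu_k\}\subset(0,\overline\mu]$; starting point $x^0\in\mathrm{dom}\,h$. For $k=0,1,2,\dots$ (no stopping test): 1. Choose $\gamma_{k,0}\in[\underline\gamma,\overline\gamma]$ and set $C^k=\vartheta(|F(x^k)|)-\langle\nabla\vartheta(|F(x^k)|),|F(x^k)|\rangle$. 2. For $j=0,1,2,\dots$: (a) choose a PD operator $\mathcal{Q}_{k,j}$ with $\gamma_{k,j}\mathcal{I}\preceq\mathcal{Q}_{k,j}\preceq\varrho\gamma_{k,j}\mathcal{I}$;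 with $$\Theta_{k,j}(x):=\langle\nabla\vartheta(|F(x^k)|),|\ell_F(x;x^k)|\rangle+\nu\psi(\ell_T(x;x^k))+\lambda h(x)+\tfrac12\|x-x^k\|_{\mathcal{Q}_{k,j}}^2+C^k$$ and $\overline{x}^{k,j}$ the unique minimizer of $\Theta_{k,j}$ over $\mathbb{X}$, find $x^{k,j}\in\mathbb{X}$ such that $\Theta_{k,j}(x^{k,j})<\Theta(x^k)$ and $\Theta_{k,j}(x^{k,j})-\Theta_{k,j}(\overline{x}^{k,j})\le\frac{\mu_k}{2}(\Theta(x^k)-\Theta_{k,j}(x^{k,j}))$. (b) If $\Theta(x^{k,j})\le\Theta_{k,j}(x^{k,j})$, set $j_k=j$ and leave the inner loop; otherwise set $\gamma_{k,j+1}=\varrho\gamma_{k,j}$. 3. Set $x^{k+1}=x^{k,j_k}$, $\overline{x}^{k+1}=\overline{x}^{k,j_k}$, $\mathcal{Q}_k=\mathcal{Q}_{k,j_k}$. **Function $\Xi$.** The formula for $\Xi$ applies for $(x,z,t)\in\mathbb{X}\times\mathcal{O}\times\mathbb{R}_+$; $\Xi=+\infty$ elsewhere on $\mathbb{X}\times\mathbb{X}\times\mathbb{R}$. **KL function.** For $\eta\in(0,\infty]$ let $\Upsilon_\eta$ be the set of continuous concave $\varphi:[0,\eta)\to\mathbb{R}_+$, continuously differentiable on $(0,\eta)$, with $\varphi(0)=0$ and $\varphi'>0$ on $(0,\eta)$. A proper lsc function $f$ has the KL property at $\overline{x}\in\mathrm{dom}\,\partial f$ if there are $\eta\in(0,\infty]$,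 $\varphi\in\Upsilon_\eta$ and a neighborhood $\mathcal{V}$ of $\overline{x}$ with $\varphi'(f(x)-f(\overline{x}))\,\mathrm{dist}(0,\partial f(x))\ge1$ for all $x\in\mathcal{V}$ with $f(\overline{x})<f(x)<f(\overline{x})+\eta$. $f$ is a KL function if it has the KL property at every point of $\mathrm{dom}\,\partial f$. *)

theory Defs
  imports "HOL-Analysis.Analysis"
begin

section \<open>Extended-real-valued functions\<close>

definition edom :: "('a \<Rightarrow> ereal) \<Rightarrow> 'a set" where
  "edom f = {x. f x < \<infinity>}"

definition proper_fun :: "('a \<Rightarrow> ereal) \<Rightarrow> bool" where
  "proper_fun f \<longleftrightarrow> (\<forall>x. f x \<noteq> -\<infinity>) \<and> edom f \<noteq> {}"

definition lsc :: "('a::topological_space \<Rightarrow> ereal) \<Rightarrow> bool" where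
  "lsc f \<longleftrightarrow> (\<forall>x. f x \<le> Liminf (nhds x) f)"

definition convex_ereal :: "('a::real_vector \<Rightarrow> ereal) \<Rightarrow> bool" where
  "convex_ereal f \<longleftrightarrow> (\<forall>x y t. 0 < t \<and> t < 1 \<longrightarrow>
     f ((1 - t) *\<^sub>R x + t *\<^sub>R y) \<le> ereal (1 - t) * f x + ereal t * f y)"

definition locally_lipschitz_on ::
  "'a::metric_space set \<Rightarrow> ('a \<Rightarrow> 'b::metric_space) \<Rightarrow> bool" where
  "locally_lipschitz_on S f \<longleftrightarrow> (\<forall>x\<in>S. \<exists>e>0. \<exists>L. L-lipschitz_on (ball x e \<inter> S) f)"

definition regular_subdiff :: "('a::euclidean_space \<Rightarrow> ereal) \<Rightarrow> 'a \<Rightarrow> 'a set" where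
  "regular_subdiff f x = {v. \<bar>f x\<bar> \<noteq> \<infinity> \<and>
     0 \<le> Liminf (at x) (\<lambda>y. (f y - f x - ereal (v \<bullet> (y - x))) / ereal (norm (y - x)))}"

text \<open>The limiting (Mordukhovich) subdifferential; it is empty where \<open>f\<close> is not finite.\<close>

definition limiting_subdiff :: "('a::euclidean_space \<Rightarrow> ereal) \<Rightarrow> 'a \<Rightarrow> 'a set" where
  "limiting_subdiff f x = {v. \<bar>f x\<bar> \<noteq> \<infinity> \<and>
     (\<exists>xs vs. xs \<longlonglongrightarrow> x \<and> (\<lambda>i. f (xs i)) \<longlonglongrightarrow> f x \<and>
        (\<forall>i. vs i \<in> regular_subdiff f (xs i)) \<and> vs \<longlonglongrightarrow> v)}"

section \<open>The Kurdyka-Lojasiewicz property\<close>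

definition Upsilon :: "ereal \<Rightarrow> (real \<Rightarrow> real) set" where
  "Upsilon \<eta> = {\<phi>.
     continuous_on {t. 0 \<le> t \<and> ereal t < \<eta>} \<phi> \<and>
     concave_on {t. 0 \<le> t \<and> ereal t < \<eta>} \<phi> \<and>
     (\<forall>t. 0 \<le> t \<and> ereal t < \<eta> \<longrightarrow> 0 \<le> \<phi> t) \<and>
     \<phi> 0 = 0 \<and>
     (\<forall>t. 0 < t \<and> ereal t < \<eta> \<longrightarrow> \<phi> differentiable (at t) \<and> 0 < deriv \<phi> t) \<and>
     continuous_on {t. 0 < t \<and> ereal t < \<eta>} (deriv \<phi>)}"

text \<open>The infimum is taken in \<^typ>\<open>ereal\<close> so that the distance to an empty
  subdifferential is \<open>\<infinity>\<close> (\<^const>\<open>infdist\<close> would give 0).\<close>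

definition dist_zero_subdiff :: "('a::euclidean_space \<Rightarrow> ereal) \<Rightarrow> 'a \<Rightarrow> ereal" where
  "dist_zero_subdiff f x = (INF v\<in>limiting_subdiff f x. ereal (norm v))"

definition KL_property_at :: "('a::euclidean_space \<Rightarrow> ereal) \<Rightarrow> 'a \<Rightarrow> bool" where
  "KL_property_at f xb \<longleftrightarrow>
     (\<exists>\<eta>>0. \<exists>\<phi>\<in>Upsilon \<eta>. \<exists>V. open V \<and> xb \<in> V \<and>
        (\<forall>x\<in>V. f xb < f x \<and> f x < f xb + \<eta> \<longrightarrow>
           1 \<le> ereal (deriv \<phi> (real_of_ereal (f x - f xb))) * dist_zero_subdiff f x))"

text \<open>The notion is usually introduced for proper lsc functions. Lower semicontinuity is not
  made part of the predicate: the potential function \<open>\<Xi>\<close> below is set to \<open>\<infinity>\<close> for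
  \<open>z\<close> outside the open set \<open>U\<close>, hence is in general not lsc at points with
  \<open>z\<close> on the boundary of \<open>U\<close>. As a hypothesis, the predicate is thus the weaker one.\<close>

definition KL_function :: "('a::euclidean_space \<Rightarrow> ereal) \<Rightarrow> bool" where
  "KL_function f \<longleftrightarrow> (\<forall>xb. limiting_subdiff f xb \<noteq> {} \<longrightarrow> KL_property_at f xb)"

section \<open>Smoothness\<close>

definition C1_on :: "'a::euclidean_space set \<Rightarrow> ('a \<Rightarrow> 'b::euclidean_space) \<Rightarrow> bool" where
  "C1_on S f \<longleftrightarrow> (\<exists>f' :: 'a \<Rightarrow> 'a \<Rightarrow>\<^sub>L 'b.
     (\<forall>x\<in>S. (f has_derivative blinfun_apply (f' x)) (at x)) \<and> continuous_on S f')"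

definition C2_on :: "'a::euclidean_space set \<Rightarrow> ('a \<Rightarrow> 'b::euclidean_space) \<Rightarrow> bool" where
  "C2_on S f \<longleftrightarrow> (\<exists>(f' :: 'a \<Rightarrow> 'a \<Rightarrow>\<^sub>L 'b) (f'' :: 'a \<Rightarrow> 'a \<Rightarrow>\<^sub>L ('a \<Rightarrow>\<^sub>L 'b)).
     (\<forall>x\<in>S. (f has_derivative blinfun_apply (f' x)) (at x)) \<and>
     (\<forall>x\<in>S. (f' has_derivative blinfun_apply (f'' x)) (at x)) \<and>
     continuous_on S f'')"

section \<open>The composite problem\<close>

text \<open>An \<open>m \<times> n\<close> matrix has type \<^typ>\<open>real^'n^'m\<close>; the library's inner product and
  norm on this type are the trace inner product and the Frobenius norm, and
  \<^term>\<open>\<bar>y\<bar>\<close> is the entrywise absolute value.\<close>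

definition vartheta :: "(real \<Rightarrow> real) \<Rightarrow> real^'n^'m \<Rightarrow> real" where
  "vartheta \<theta> z = (\<Sum>i\<in>UNIV. \<Sum>j\<in>UNIV. \<theta> (z $ i $ j))"

definition grad_vartheta :: "(real \<Rightarrow> real) \<Rightarrow> real^'n^'m \<Rightarrow> real^'n^'m" where
  "grad_vartheta \<theta> z = (\<chi> i j. deriv \<theta> (z $ i $ j))"

definition standing_assumption ::
  "('a::euclidean_space \<Rightarrow> ereal) \<Rightarrow> 'a set \<Rightarrow> ('a \<Rightarrow> real^'n^'m) \<Rightarrow> ('a \<Rightarrow> real^'q^'p) \<Rightarrow>
   (real^'q^'p \<Rightarrow> real) \<Rightarrow> real set \<Rightarrow> (real \<Rightarrow> real) \<Rightarrow> bool" where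
  "standing_assumption h U F T \<psi> I \<theta> \<longleftrightarrow>
     proper_fun h \<and> lsc h \<and> convex_ereal h \<and> (\<exists>c. \<forall>x. ereal c \<le> h x) \<and>
     locally_lipschitz_on (edom h) (\<lambda>x. real_of_ereal (h x)) \<and>
     open U \<and> edom h \<subseteq> U \<and> C1_on U F \<and> C1_on U T \<and>
     convex_on UNIV \<psi> \<and> (\<exists>c. \<forall>y. c \<le> \<psi> y) \<and>
     open I \<and> is_interval I \<and> {0..} \<subseteq> I \<and>
     concave_on I \<theta> \<and> (\<forall>t\<in>I. \<theta> differentiable (at t)) \<and> locally_lipschitz_on I (deriv \<theta>) \<and>
     (\<forall>t\<ge>0. 0 \<le> deriv \<theta> t) \<and> \<theta> 0 = 0"

text \<open>Since \<open>lam > 0\<close>, the value is \<open>\<infinity>\<close> outside \<^term>\<open>edom h\<close>, where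
  \<open>F\<close> and \<open>T\<close> may be meaningless.\<close>

definition Theta ::
  "('a::euclidean_space \<Rightarrow> ereal) \<Rightarrow> ('a \<Rightarrow> real^'n^'m) \<Rightarrow> ('a \<Rightarrow> real^'q^'p) \<Rightarrow>
   (real^'q^'p \<Rightarrow> real) \<Rightarrow> (real \<Rightarrow> real) \<Rightarrow> real \<Rightarrow> real \<Rightarrow> 'a \<Rightarrow> ereal" where
  "Theta h F T \<psi> \<theta> \<nu> lam x =
     ereal (vartheta \<theta> \<bar>F x\<bar>) + ereal (\<nu> * \<psi> (T x)) + ereal lam * h x"

definition lin_at ::
  "('a::real_normed_vector \<Rightarrow> 'b::real_normed_vector) \<Rightarrow> 'a \<Rightarrow> 'a \<Rightarrow> 'b" where
  "lin_at G x z = G z + frechet_derivative G (at z) (x - z)"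

definition abs_subdiff :: "real \<Rightarrow> real set" where
  "abs_subdiff s = (if s = 0 then {-1..1} else {sgn s})"

definition circ_abs_subdiff :: "real^'n^'m \<Rightarrow> real^'n^'m \<Rightarrow> (real^'n^'m) set" where
  "circ_abs_subdiff y w = {v. \<forall>i j. v $ i $ j \<in> (\<lambda>s. y $ i $ j * s) ` abs_subdiff (w $ i $ j)}"

definition stationary_points ::
  "('a::euclidean_space \<Rightarrow> ereal) \<Rightarrow> ('a \<Rightarrow> real^'n^'m) \<Rightarrow> ('a \<Rightarrow> real^'q^'p) \<Rightarrow>
   (real^'q^'p \<Rightarrow> real) \<Rightarrow> (real \<Rightarrow> real) \<Rightarrow> real \<Rightarrow> real \<Rightarrow> 'a set" where
  "stationary_points h F T \<psi> \<theta> \<nu> lam = {x \<in> edom h.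
     \<exists>v \<in> circ_abs_subdiff (grad_vartheta \<theta> \<bar>F x\<bar>) (F x).
     \<exists>w \<in> limiting_subdiff (\<lambda>y. ereal (\<psi> y)) (T x).
     \<exists>u \<in> limiting_subdiff h x.
       0 = adjoint (frechet_derivative F (at x)) v
           + \<nu> *\<^sub>R adjoint (frechet_derivative T (at x)) w + lam *\<^sub>R u}"

section \<open>The algorithm iPMM\<close>

definition PD_operator :: "('a::real_inner \<Rightarrow> 'a) \<Rightarrow> bool" where
  "PD_operator Q \<longleftrightarrow> linear Q \<and> (\<forall>x y. Q x \<bullet> y = x \<bullet> Q y) \<and> (\<forall>x. x \<noteq> 0 \<longrightarrow> 0 < x \<bullet> Q x)"

definition loewner_le :: "('a::real_inner \<Rightarrow> 'a) \<Rightarrow> ('a \<Rightarrow> 'a) \<Rightarrow> bool" where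
  "loewner_le A B \<longleftrightarrow> (\<forall>x. x \<bullet> A x \<le> x \<bullet> B x)"

definition Qnorm :: "('a::real_inner \<Rightarrow> 'a) \<Rightarrow> 'a \<Rightarrow> real" where
  "Qnorm Q x = sqrt (x \<bullet> Q x)"

text \<open>The model function \<open>\<Theta>\<^sub>k\<^sub>,\<^sub>j\<close>, with \<open>xk\<close> the current iterate and \<open>Q\<close> the current
  operator; the last summand is the constant \<open>C\<^sup>k\<close>.\<close>

definition Theta_model ::
  "('a::euclidean_space \<Rightarrow> ereal) \<Rightarrow> ('a \<Rightarrow> real^'n^'m) \<Rightarrow> ('a \<Rightarrow> real^'q^'p) \<Rightarrow>
   (real^'q^'p \<Rightarrow> real) \<Rightarrow> (real \<Rightarrow> real) \<Rightarrow> real \<Rightarrow> real \<Rightarrow> 'a \<Rightarrow> ('a \<Rightarrow> 'a) \<Rightarrow> 'a \<Rightarrow> ereal" where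
  "Theta_model h F T \<psi> \<theta> \<nu> lam xk Q x =
     ereal (grad_vartheta \<theta> \<bar>F xk\<bar> \<bullet> \<bar>lin_at F x xk\<bar>) + ereal (\<nu> * \<psi> (lin_at T x xk))
     + ereal lam * h x + ereal (1/2 * (Qnorm Q (x - xk))\<^sup>2)
     + ereal (vartheta \<theta> \<bar>F xk\<bar> - grad_vartheta \<theta> \<bar>F xk\<bar> \<bullet> \<bar>F xk\<bar>)"

text \<open>\<open>iPMM_run\<close> says that the iterates \<open>x k\<close>, together with \<open>\<gamma> k j\<close>, \<open>Q k j\<close>,
  inexact solutions \<open>xin k j\<close>, exact solutions \<open>xb k j\<close> and numbers \<open>jj k\<close> of the accepted
  inner step, form an infinite run; entries with \<open>j > jj k\<close> are never computed and are
  unconstrained. Uniqueness of the minimizer \<open>xb k j\<close> is automatic by strong convexity of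
  the model.\<close>

definition iPMM_run ::
  "('a::euclidean_space \<Rightarrow> ereal) \<Rightarrow> ('a \<Rightarrow> real^'n^'m) \<Rightarrow> ('a \<Rightarrow> real^'q^'p) \<Rightarrow>
   (real^'q^'p \<Rightarrow> real) \<Rightarrow> (real \<Rightarrow> real) \<Rightarrow> real \<Rightarrow> real \<Rightarrow>
   real \<Rightarrow> real \<Rightarrow> real \<Rightarrow> real \<Rightarrow> (nat \<Rightarrow> real) \<Rightarrow>
   (nat \<Rightarrow> 'a) \<Rightarrow> (nat \<Rightarrow> nat \<Rightarrow> real) \<Rightarrow> (nat \<Rightarrow> nat \<Rightarrow> 'a \<Rightarrow> 'a) \<Rightarrow>
   (nat \<Rightarrow> nat \<Rightarrow> 'a) \<Rightarrow> (nat \<Rightarrow> nat \<Rightarrow> 'a) \<Rightarrow> (nat \<Rightarrow> nat) \<Rightarrow> bool" where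
  "iPMM_run h F T \<psi> \<theta> \<nu> lam \<rho> \<gamma>lo \<gamma>hi \<mu>max \<mu> x \<gamma> Q xin xb jj \<longleftrightarrow>
     1 < \<rho> \<and> 0 < \<gamma>lo \<and> \<gamma>lo < \<gamma>hi \<and> 0 < \<mu>max \<and> (\<forall>k. 0 < \<mu> k \<and> \<mu> k \<le> \<mu>max) \<and>
     x 0 \<in> edom h \<and>
     (\<forall>k. let obj = Theta h F T \<psi> \<theta> \<nu> lam;
              model = (\<lambda>j. Theta_model h F T \<psi> \<theta> \<nu> lam (x k) (Q k j))
          in
          \<gamma>lo \<le> \<gamma> k 0 \<and> \<gamma> k 0 \<le> \<gamma>hi \<and>
          (\<forall>j\<le>jj k.
             PD_operator (Q k j) \<and>
             loewner_le (\<lambda>v. \<gamma> k j *\<^sub>R v) (Q k j) \<and>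
             loewner_le (Q k j) (\<lambda>v. (\<rho> * \<gamma> k j) *\<^sub>R v) \<and>
             is_arg_min (model j) (\<lambda>_. True) (xb k j) \<and>
             model j (xin k j) < obj (x k) \<and>
             model j (xin k j) - model j (xb k j)
               \<le> ereal (\<mu> k / 2) * (obj (x k) - model j (xin k j))) \<and>
          (\<forall>j<jj k. \<not> obj (xin k j) \<le> model j (xin k j) \<and> \<gamma> k (Suc j) = \<rho> * \<gamma> k j) \<and>
          obj (xin k (jj k)) \<le> model (jj k) (xin k (jj k)) \<and>
          x (Suc k) = xin k (jj k))"

section \<open>The potential function\<close>

definition Xi ::
  "('a::euclidean_space \<Rightarrow> ereal) \<Rightarrow> 'a set \<Rightarrow> ('a \<Rightarrow> real^'n^'m) \<Rightarrow> ('a \<Rightarrow> real^'q^'p) \<Rightarrow>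
   (real^'q^'p \<Rightarrow> real) \<Rightarrow> (real \<Rightarrow> real) \<Rightarrow> real \<Rightarrow> real \<Rightarrow> real \<Rightarrow> 'a \<times> 'a \<times> real \<Rightarrow> ereal" where
  "Xi h U F T \<psi> \<theta> \<nu> lam \<gamma>hat = (\<lambda>(x, z, t).
     if z \<in> U \<and> 0 \<le> t then
       ereal (vartheta \<theta> \<bar>lin_at F x z\<bar>) + ereal (\<nu> * \<psi> (lin_at T x z)) + ereal lam * h x
       + ereal (\<gamma>hat / 2 * (norm (x - z))\<^sup>2) + ereal (t\<^sup>2)
     else \<infinity>)"

end

theory Submission
  imports Defs
begin

text \<open>Write \<open>r\<^sub>k = \<Theta>(x\<^sup>k) - \<Theta>\<^sub>k(x\<^sup>k\<^sup>+\<^sup>1) > 0\<close> for the decrease of the accepted model. Strong convexity of the model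
  and the inexactness criterion bound \<open>\<parallel>x\<^sup>k\<^sup>+\<^sup>1 - x\<^sup>k\<parallel>\<close> and the distance of \<open>x\<^sup>k\<close> to the exact minimizer \<open>y\<^sup>k\<close> of the
  model by a multiple of \<open>\<surd>r\<^sub>k\<close>, while \<open>\<Theta>(x\<^sup>k\<^sup>+\<^sup>1) \<le> \<Theta>(x\<^sup>k) - r\<^sub>k\<close>. The KL inequality for \<open>\<Xi>\<close> is used at the
  points \<open>p\<^sub>k = (y\<^sup>k, x\<^sup>k, \<surd>(B r\<^sub>k))\<close>: for a large constant \<open>B\<close> one has \<open>\<Theta>(x\<^sup>k\<^sup>+\<^sup>1) \<le> \<Xi>(p\<^sub>k)\<close>, and the optimality
  condition of \<open>y\<^sup>k\<close> yields a subgradient of \<open>\<Xi>\<close> at \<open>p\<^sub>k\<close> of norm \<open>O(\<surd>r\<^sub>k)\<close>. As \<open>\<phi>'\<close> is decreasing, the KL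
  inequality at \<open>p\<^sub>k\<close> transfers to the value \<open>\<Theta>(x\<^sup>k\<^sup>+\<^sup>1)\<close>, and the usual telescoping gives
  \<open>2 \<surd>r\<^sub>k\<^sub>+\<^sub>1 \<le> \<surd>r\<^sub>k + C (\<phi>\<^sub>k\<^sub>+\<^sub>1 - \<phi>\<^sub>k\<^sub>+\<^sub>2)\<close>, hence a finite length. Stationarity of the limit follows by
  passing to the limit in the optimality condition of \<open>y\<^sup>k\<close>.\<close>

section \<open>Convex functions\<close>

text \<open>The inexactness test controls function values only, so \<open>x (Suc k)\<close> comes
  with no approximate optimality condition; this is why the subgradient is taken at the exact
  minimizer \<open>y k\<close>. The price is that the potential at \<open>y k\<close> has no a
  priori order relation to the objective at \<open>x (Suc k)\<close>. The third variable of
  \<open>Xi\<close> repairs this: raising the value by \<open>B * gap k\<close> adds only a multiple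
  of \<open>sqrt (gap k)\<close> to the subgradient. A second mismatch is that the model freezes the
  weights \<theta>' at \<open>|F (x k)|\<close>, while \<open>Xi\<close> differentiates \<theta> at
  the linearised point. Both weightings can carry the same signs, so the difference is governed by a
  Lipschitz constant of \<theta>'. In the variable \<open>z\<close> the first-order terms of
  \<open>F z + F' z (x - z)\<close> cancel and leave a second derivative applied to
  \<open>x - z\<close>, so this component is small as well. The calculus uses only the inclusions
  that hold for regular subgradients of arbitrary functions: sums of subgradients, and composition
  with a differentiable map. Hence the nonconvex term in \<theta> causes no difficulty.\<close>

lemma concave_on_tangent:
  fixes f :: "real \<Rightarrow> real"
  assumes "concave_on A f" "connected A" "c \<in> interior A" "x \<in> A" "f differentiable (at c)"
  shows "f x \<le> f c + deriv f c * (x - c)"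
proof -
  have "(f has_real_derivative deriv f c) (at c)"
    using assms(5) by (simp add: DERIV_deriv_iff_real_differentiable)
  then have "((\<lambda>x. - f x) has_real_derivative - deriv f c) (at c within A)"
    by (auto intro!: derivative_eq_intros intro: has_field_derivative_at_within)
  from convex_on_imp_above_tangent[OF _ assms(2,3,4) this] assms(1)
  show ?thesis by (simp add: concave_on_def)
qed

lemma convex_edom: "convex_ereal h \<Longrightarrow> convex (edom h)"
proof (rule convexI)
  fix x y and u v :: real
  assume h: "convex_ereal h" and xy: "x \<in> edom h" "y \<in> edom h" and uv: "0 \<le> u" "0 \<le> v" "u + v = 1"
  show "u *\<^sub>R x + v *\<^sub>R y \<in> edom h"
  proof (cases "u = 0 \<or> v = 0")
    case True
    then show ?thesis using uv xy by auto
  next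
    case False
    then have v: "0 < v" "v < 1" and u: "u = 1 - v" using uv by auto
    have "h (u *\<^sub>R x + v *\<^sub>R y) \<le> ereal (1 - v) * h x + ereal v * h y"
      using h v unfolding convex_ereal_def u by blast
    also have "\<dots> < \<infinity>"
      using xy v by (cases "h x"; cases "h y") (auto simp: edom_def)
    finally show ?thesis by (simp add: edom_def)
  qed
qed

lemma convex_on_real_of_ereal:
  assumes h: "convex_ereal h" and fin: "\<And>x. h x \<noteq> -\<infinity>"
  shows "convex_on (edom h) (\<lambda>x. real_of_ereal (h x))"
proof (rule convex_onI)
  fix t x y
  assume t: "0 < t" "t < (1::real)" and xy: "x \<in> edom h" "y \<in> edom h"
  obtain a b where a: "h x = ereal a" and b: "h y = ereal b"
    using xy fin[of x] fin[of y] by (cases "h x"; cases "h y") (auto simp: edom_def)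
  have le: "h ((1 - t) *\<^sub>R x + t *\<^sub>R y) \<le> ereal (1 - t) * h x + ereal t * h y"
    using h t unfolding convex_ereal_def by blast
  show "real_of_ereal (h ((1 - t) *\<^sub>R x + t *\<^sub>R y))
      \<le> (1 - t) * real_of_ereal (h x) + t * real_of_ereal (h y)"
    using le fin[of "(1 - t) *\<^sub>R x + t *\<^sub>R y"] unfolding a b
    by (cases "h ((1 - t) *\<^sub>R x + t *\<^sub>R y)") auto
qed (rule convex_edom[OF h])

text \<open>Fenchel duality without constraint qualification, since \<open>g\<close> is finite everywhere: the strict
  epigraph of \<open>g\<close> is separated from the image under \<open>A\<close> of the hypograph of \<open>g (A x) + h x - h\<close>.\<close>

lemma composite_minimizer_subgradient:
  fixes g :: "'b::euclidean_space \<Rightarrow> real" and A :: "'a::real_vector \<Rightarrow> 'b"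
  assumes g: "convex_on UNIV g" and h: "convex_on D h" and x: "x \<in> D"
    and A: "\<And>u y z. A ((1 - u) *\<^sub>R y + u *\<^sub>R z) = (1 - u) *\<^sub>R A y + u *\<^sub>R A z"
    and min: "\<And>z. z \<in> D \<Longrightarrow> g (A x) + h x \<le> g (A z) + h z"
  obtains w where "\<And>y. g (A x) + w \<bullet> (y - A x) \<le> g y"
    and "\<And>z. z \<in> D \<Longrightarrow> h x - w \<bullet> (A z - A x) \<le> h z"
proof -
  define S where "S = {p. g (fst p) < snd p}"
  define T where "T = {p. \<exists>z\<in>D. fst p = A z \<and> snd p \<le> g (A x) + h x - h z}"
  have S: "convex S"
  proof (rule convexI)
    fix p q and u v :: real
    assume pq: "p \<in> S" "q \<in> S" and uv: "0 \<le> u" "0 \<le> v" "u + v = 1"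
    have "g (u *\<^sub>R fst p + v *\<^sub>R fst q) \<le> u * g (fst p) + v * g (fst q)"
      using g uv by (auto simp: convex_on_def)
    also have "\<dots> < u * snd p + v * snd q"
    proof (cases "u = 0")
      case True
      then show ?thesis using uv pq by (auto simp: S_def)
    next
      case False
      then show ?thesis using uv pq
        by (intro add_less_le_mono mult_strict_left_mono mult_left_mono) (auto simp: S_def)
    qed
    finally show "u *\<^sub>R p + v *\<^sub>R q \<in> S" by (simp add: S_def)
  qed
  have T: "convex T"
  proof (rule convexI)
    fix p q and u v :: real
    assume pq: "p \<in> T" "q \<in> T" and uv: "0 \<le> u" "0 \<le> v" "u + v = 1"
    then obtain y z where y: "y \<in> D" "fst p = A y" "snd p \<le> g (A x) + h x - h y"
      and z: "z \<in> D" "fst q = A z" "snd q \<le> g (A x) + h x - h z" by (auto simp: T_def)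
    have "h (u *\<^sub>R y + v *\<^sub>R z) \<le> u * h y + v * h z"
      using h uv y z by (auto simp: convex_on_def)
    moreover have "u * snd p + v * snd q \<le> u * (g (A x) + h x - h y) + v * (g (A x) + h x - h z)"
      using uv y z by (intro add_mono mult_left_mono) auto
    moreover have "u * (g (A x) + h x) + v * (g (A x) + h x) = g (A x) + h x"
      using uv by (simp flip: distrib_right)
    ultimately have "u * snd p + v * snd q \<le> g (A x) + h x - h (u *\<^sub>R y + v *\<^sub>R z)"
      by (simp add: algebra_simps)
    moreover have "A (u *\<^sub>R y + v *\<^sub>R z) = u *\<^sub>R A y + v *\<^sub>R A z"
    proof -
      have "u = 1 - v" using uv by simp
      then show ?thesis using A[of v y z] by simp
    qed
    moreover have "u *\<^sub>R y + v *\<^sub>R z \<in> D"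
      using h uv y z by (auto simp: convex_on_def convex_def)
    ultimately show "u *\<^sub>R p + v *\<^sub>R q \<in> T"
      using y z by (auto simp: T_def intro!: bexI[of _ "u *\<^sub>R y + v *\<^sub>R z"])
  qed
  have "(A x, g (A x) + 1) \<in> S" "(A x, g (A x)) \<in> T"
    using x by (auto simp: S_def T_def intro!: bexI[of _ x])
  moreover have "S \<inter> T = {}" using min by (force simp: S_def T_def)
  ultimately obtain a b where a: "a \<noteq> 0" and aS: "\<And>p. p \<in> S \<Longrightarrow> a \<bullet> p \<le> b"
    and aT: "\<And>p. p \<in> T \<Longrightarrow> b \<le> a \<bullet> p"
    using separating_hyperplane_sets[OF S T] by blast
  obtain v \<alpha> where av: "a = (v, \<alpha>)" by (cases a)
  have le: "v \<bullet> y + \<alpha> * s \<le> b" if "g y < s" for y s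
    using aS[of "(y, s)"] that by (simp add: av S_def)
  have ge: "b \<le> v \<bullet> A z + \<alpha> * (g (A x) + h x - h z)" if "z \<in> D" for z
    using aT[of "(A z, g (A x) + h x - h z)"] that by (auto simp: av T_def)
  \<comment> \<open>The separating hyperplane is not vertical. A positive \<open>\<alpha>\<close> is
    impossible since \<open>S\<close> is unbounded upwards; for \<open>\<alpha> = 0\<close> the
    nonzero functional \<open>v\<close> would be bounded above on the whole space, because
    \<open>g\<close> is finite everywhere.\<close>
  have \<alpha>: "\<alpha> < 0"
  proof (rule ccontr)
    assume "\<not> \<alpha> < 0"
    moreover have "\<alpha> \<le> 0"
    proof (rule ccontr)
      assume "\<not> \<alpha> \<le> 0"
      define s where "s = max (g 0 + 1) (b / \<alpha> + 1)"
      have "g 0 < s" by (auto simp: s_def)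
      from le[OF this] have "\<alpha> * s \<le> b" by simp
      moreover have "b / \<alpha> < s" by (auto simp: s_def)
      ultimately show False using \<open>\<not> \<alpha> \<le> 0\<close> by (simp add: field_simps)
    qed
    ultimately have 0: "\<alpha> = 0" by simp
    then have v: "v \<noteq> 0" using a av by (auto simp: zero_prod_def)
    have "v \<bullet> y \<le> b" for y using le[of y "g y + 1"] 0 by simp
    from this[of "((b + 1) / (v \<bullet> v)) *\<^sub>R v"] show False using v by simp
  qed
  have le': "v \<bullet> y + \<alpha> * g y \<le> b" for y
  proof (rule field_le_epsilon)
    fix e :: real assume "0 < e"
    then have "g y < g y + e / - \<alpha>" using \<alpha> by (simp add: field_simps)
    from le[OF this] show "v \<bullet> y + \<alpha> * g y \<le> b + e" using \<alpha> by (simp add: right_diff_distrib)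
  qed
  define w where "w = (1 / - \<alpha>) *\<^sub>R v"
  have w: "w \<bullet> y = v \<bullet> y / - \<alpha>" for y by (simp add: w_def)
  show thesis
  proof (rule that)
    fix y
    have "v \<bullet> y + \<alpha> * g y \<le> v \<bullet> A x + \<alpha> * g (A x)"
      using le'[of y] ge[OF x] by simp
    then show "g (A x) + w \<bullet> (y - A x) \<le> g y"
      using \<alpha> unfolding w inner_diff_right by (simp add: field_simps)
  next
    fix z assume "z \<in> D"
    have "v \<bullet> A x + \<alpha> * g (A x) \<le> v \<bullet> A z + \<alpha> * (g (A x) + h x - h z)"
      using le'[of "A x"] ge[OF \<open>z \<in> D\<close>] by simp
    then show "h x - w \<bullet> (A z - A x) \<le> h z"
      using \<alpha> unfolding w inner_diff_right by (simp add: field_simps)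
  qed
qed

text \<open>Compare \<open>y\<close> with the points on the segment towards \<open>z\<close>: after
  division by the step \<open>s\<close>, the quadratic term in \<open>z - y\<close> is of order
  \<open>s\<close> and vanishes as \<open>s\<close> tends to 0 from the right.\<close>

lemma prox_minimizer_variational_inequality:
  fixes f :: "'a::real_inner \<Rightarrow> real"
  assumes f: "convex_on D f" and Q: "linear Q" "\<And>u v. Q u \<bullet> v = u \<bullet> Q v"
    and y: "y \<in> D" and z: "z \<in> D"
    and min: "\<And>z. z \<in> D \<Longrightarrow> f y + 1/2 * ((y - x) \<bullet> Q (y - x)) \<le> f z + 1/2 * ((z - x) \<bullet> Q (z - x))"
  shows "f y - Q (y - x) \<bullet> (z - y) \<le> f z"
proof -
  define a where "a = f z - f y + Q (y - x) \<bullet> (z - y)"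
  define q where "q = (z - y) \<bullet> Q (z - y)"
  have 1: "0 \<le> a + s / 2 * q" if s: "0 < s" "s < 1" for s
  proof -
    define p where "p = (1 - s) *\<^sub>R y + s *\<^sub>R z"
    have p: "p \<in> D" using f y z s by (auto simp: convex_on_def convex_def p_def)
    have fp: "f p \<le> (1 - s) * f y + s * f z"
      using f y z s by (auto simp: convex_on_def p_def)
    have px: "p - x = (y - x) + s *\<^sub>R (z - y)" by (simp add: p_def algebra_simps)
    have "(u + s *\<^sub>R v) \<bullet> Q (u + s *\<^sub>R v) = u \<bullet> Q u + 2 * s * (Q u \<bullet> v) + s * s * (v \<bullet> Q v)" for u v
      using Q(2)[of u v] unfolding linear_add[OF Q(1)] linear_cmul[OF Q(1)]
      by (simp add: inner_add_left inner_add_right distrib_left inner_commute[of v "Q u"])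
    then have "(p - x) \<bullet> Q (p - x)
        = (y - x) \<bullet> Q (y - x) + 2 * s * (Q (y - x) \<bullet> (z - y)) + s * s * q"
      unfolding px q_def by blast
    with min[OF p] fp have "0 \<le> s * (f z - f y) + s * (Q (y - x) \<bullet> (z - y)) + s * s * q / 2"
      by (simp add: algebra_simps)
    then have "0 \<le> s * (a + s / 2 * q)" by (simp add: a_def algebra_simps)
    then show ?thesis using s by (simp add: zero_le_mult_iff)
  qed
  have "((\<lambda>s. a + s / 2 * q) \<longlongrightarrow> a + 0 / 2 * q) (at_right 0)"
    by (intro tendsto_intros) auto
  moreover have "\<forall>\<^sub>F s in at_right 0. 0 \<le> a + s / 2 * q"
    using eventually_at_right_real[of 0 1] by (rule eventually_mono) (use 1 in auto)
  ultimately have "0 \<le> a + 0 / 2 * q"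
    by (rule tendsto_lowerbound) simp
  then show ?thesis by (simp add: a_def)
qed

text \<open>Positivity of \<open>Q\<close> is tested at \<open>c v - Q v\<close>; bounding the two
  forms at \<open>v\<close> and at \<open>Q v\<close> from above leaves exactly the claim, without
  any spectral decomposition.\<close>

lemma norm_selfadjoint_le:
  fixes Q :: "'a::real_inner \<Rightarrow> 'a"
  assumes Q: "linear Q" "\<And>u v. Q u \<bullet> v = u \<bullet> Q v" and pos: "\<And>v. 0 \<le> v \<bullet> Q v"
    and le: "\<And>v. v \<bullet> Q v \<le> c * (norm v)\<^sup>2" and c: "0 < c"
  shows "norm (Q v) \<le> c * norm v"
proof -
  have "0 \<le> (c *\<^sub>R v - Q v) \<bullet> Q (c *\<^sub>R v - Q v)" by (rule pos)
  also have "\<dots> = c\<^sup>2 * (v \<bullet> Q v) - 2 * c * (norm (Q v))\<^sup>2 + Q v \<bullet> Q (Q v)"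
  proof -
    have "(c *\<^sub>R v - Q v) \<bullet> Q (c *\<^sub>R v - Q v)
        = c * (c * (v \<bullet> Q v)) - c * (v \<bullet> Q (Q v)) - c * (Q v \<bullet> Q v) + Q v \<bullet> Q (Q v)"
      unfolding linear_diff[OF Q(1)] linear_cmul[OF Q(1)] inner_diff_left inner_diff_right
        inner_scaleR_left inner_scaleR_right by (simp add: right_diff_distrib)
    moreover have "c * (c * p) - c * q - c * q + s = c\<^sup>2 * p - 2 * c * q + s" for p q s
      by (simp add: power2_eq_square)
    ultimately show ?thesis unfolding Q(2)[of v "Q v", symmetric] power2_norm_eq_inner by simp
  qed
  also have "\<dots> \<le> c\<^sup>2 * (c * (norm v)\<^sup>2) - 2 * c * (norm (Q v))\<^sup>2 + c * (norm (Q v))\<^sup>2"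
    using le[of v] le[of "Q v"] c by (intro add_mono diff_mono mult_left_mono) auto
  finally have "c * (norm (Q v))\<^sup>2 \<le> c * (c * norm v)\<^sup>2"
    by (simp add: power_mult_distrib power2_eq_square algebra_simps)
  then show ?thesis using c by (auto intro: power2_le_imp_le)
qed

text \<open>A unit step from \<open>y\<close> in the direction of \<open>w\<close> raises
  \<open>g\<close> by at least \<open>norm w\<close>, and \<open>g\<close> is bounded on a ball one
  unit larger than one containing \<open>B\<close>.\<close>

lemma subgradients_bounded:
  fixes g :: "'a::euclidean_space \<Rightarrow> real"
  assumes g: "convex_on UNIV g" and B: "bounded B"
  obtains C where "0 \<le> C"
    and "\<And>y w. \<lbrakk>y \<in> B; \<And>z. g y + w \<bullet> (z - y) \<le> g z\<rbrakk> \<Longrightarrow> norm w \<le> C"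
proof -
  obtain r where r: "\<And>y. y \<in> B \<Longrightarrow> norm y \<le> r" "0 < r" using B by (auto simp: bounded_pos)
  have g: "continuous_on (cball 0 (r + 1)) g"
    using convex_on_continuous[OF open_UNIV g] continuous_on_subset by blast
  then obtain c where c: "\<And>y. y \<in> cball 0 (r + 1) \<Longrightarrow> \<bar>g y\<bar> \<le> c"
    using compact_imp_bounded[OF compact_continuous_image[OF g compact_cball]]
    unfolding bounded_iff by force
  show thesis
  proof (rule that)
    show "0 \<le> 2 * c" using c[of 0] r(2) by fastforce
    fix y w assume y: "y \<in> B" and w: "\<And>z. g y + w \<bullet> (z - y) \<le> g z"
    have "norm (y + sgn w) \<le> norm y + norm (sgn w)" by (rule norm_triangle_ineq)
    also have "\<dots> \<le> r + 1" using r(1)[OF y] by (simp add: norm_sgn)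
    finally have "\<bar>g (y + sgn w)\<bar> \<le> c" by (intro c) simp
    moreover have "\<bar>g y\<bar> \<le> c" using r(1)[OF y] by (intro c) simp
    moreover have "w \<bullet> sgn w = norm w"
      by (cases "w = 0") (auto simp: sgn_div_norm power2_norm_eq_inner[symmetric] power2_eq_square)
    ultimately show "norm w \<le> 2 * c" using w[of "y + sgn w"] by simp
  qed
qed

section \<open>Local Lipschitz continuity, lower semicontinuity and compactness\<close>

lemma lipschitz_on_compactI:
  fixes f :: "'a::metric_space \<Rightarrow> 'b::metric_space"
  assumes f: "locally_lipschitz_on S f" and K: "compact K" "K \<subseteq> S"
  obtains L where "L-lipschitz_on K f"
proof -
  \<comment> \<open>\<open>local_lipschitz\<close> speaks of time-dependent maps, so
    \<open>f\<close> is viewed as a map that is constant over the single time 0.\<close>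
  have "local_lipschitz {0::real} K (\<lambda>_. f)"
    unfolding local_lipschitz_def
  proof (intro ballI)
    fix x t assume "x \<in> K"
    then obtain e L where "0 < e" "L-lipschitz_on (ball x e \<inter> S) f"
      using f K unfolding locally_lipschitz_on_def by blast
    then have "L-lipschitz_on (cball x (e / 2) \<inter> K) f"
      using K by (auto intro: lipschitz_on_subset)
    then show "\<exists>u>0. \<exists>L. \<forall>t\<in>cball t u \<inter> {0}. L-lipschitz_on (cball x u \<inter> K) f"
      using \<open>0 < e\<close> by (intro exI[of _ "e / 2"]) auto
  qed
  from local_lipschitz_compact_implies_lipschitz[OF this K(1)] that show thesis by auto
qed

lemma locally_lipschitz_on_imp_continuous_on:
  assumes "locally_lipschitz_on S f" shows "continuous_on S f"
proof -
  have "continuous (at x within S) f" if x: "x \<in> S" for x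
  proof -
    obtain e L where e: "0 < e" and L: "L-lipschitz_on (ball x e \<inter> S) f"
      using assms x unfolding locally_lipschitz_on_def by blast
    have "continuous (at x within S \<inter> ball x e) f"
      using lipschitz_on_continuous_on[OF L] x e
      by (auto simp: continuous_on_eq_continuous_within Int_commute)
    moreover have "at x within S \<inter> ball x e = at x within S"
      by (rule at_within_nhd[of x "ball x e"]) (use e in auto)
    ultimately show ?thesis by (simp add: continuous_within)
  qed
  then show ?thesis by (auto simp: continuous_on_eq_continuous_within)
qed

lemma convex_on_compose_affine:
  fixes g :: "'b::real_vector \<Rightarrow> real"
  assumes g: "convex_on UNIV g" and D: "convex D"
    and A: "\<And>u y z. A ((1 - u) *\<^sub>R y + u *\<^sub>R z) = (1 - u) *\<^sub>R A y + u *\<^sub>R A z"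
  shows "convex_on D (\<lambda>z. g (A z))"
  using g D by (intro convex_onI) (auto simp: A convex_on_def)

lemma convex_on_inner: "convex D \<Longrightarrow> convex_on D (\<lambda>z. a \<bullet> z)"
  by (intro convex_onI) (simp_all add: inner_add_right)

lemma closed_sublevel_lsc:
  assumes "lsc f" shows "closed {z. f z \<le> a}"
proof -
  have "open (- {z. f z \<le> a})"
  proof (subst open_subopen, intro ballI)
    fix z assume "z \<in> - {z. f z \<le> a}"
    then have "a < Liminf (nhds z) f" using assms by (auto simp: lsc_def not_le intro: less_le_trans)
    then have "\<forall>\<^sub>F y in nhds z. a < f y" by (rule less_LiminfD)
    then obtain S where "open S" "z \<in> S" "\<And>y. y \<in> S \<Longrightarrow> a < f y"
      unfolding eventually_nhds by blast
    then show "\<exists>S. open S \<and> z \<in> S \<and> S \<subseteq> - {z. f z \<le> a}"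
      by (intro exI[of _ S]) (auto simp flip: not_less)
  qed
  then show ?thesis by (simp add: closed_def)
qed

lemma decseq_bounded_convergent:
  fixes a :: "nat \<Rightarrow> real"
  assumes "\<And>k. a (Suc k) \<le> a k" "\<And>k. b \<le> a k"
  obtains l where "a \<longlonglongrightarrow> l" "\<And>k. l \<le> a k"
  using decseq_convergent[of a b] assms by (auto simp: decseq_Suc_iff)

lemma continuous_image_bound:
  fixes f :: "'a::metric_space \<Rightarrow> 'b::real_normed_vector"
  assumes "continuous_on U f" "compact K" "K \<subseteq> U"
  obtains M where "\<And>z. z \<in> K \<Longrightarrow> norm (f z) \<le> M"
  using compact_imp_bounded[OF compact_continuous_image[OF continuous_on_subset[OF assms(1,3)] assms(2)]]
  by (auto simp: bounded_iff)

section \<open>Regular subgradients\<close>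

text \<open>Subgradients are represented by the linear functionals they induce, which turns the chain rule
  into a composition.\<close>

definition regular_subgradient ::
  "('a::real_normed_vector \<Rightarrow> real) \<Rightarrow> 'a set \<Rightarrow> 'a \<Rightarrow> ('a \<Rightarrow> real) \<Rightarrow> bool" where
  "regular_subgradient f D x v \<longleftrightarrow>
     (\<forall>e>0. \<forall>\<^sub>F y in at x within D. f x + v (y - x) - e * norm (y - x) \<le> f y)"

lemma regular_subgradient_affine_minorant:
  assumes "\<And>y. y \<in> D \<Longrightarrow> f x + v (y - x) \<le> f y"
  shows "regular_subgradient f D x v"
  unfolding regular_subgradient_def eventually_at_filter
proof (intro allI impI always_eventually)
  fix e :: real and y assume "0 < e" "y \<noteq> x" "y \<in> D"
  moreover have "0 \<le> e * norm (y - x)" using \<open>0 < e\<close> by simp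
  ultimately show "f x + v (y - x) - e * norm (y - x) \<le> f y"
    using assms[of y] by linarith
qed

lemma regular_subgradient_has_derivative:
  fixes f :: "'a::real_normed_vector \<Rightarrow> real"
  assumes "(f has_derivative v) (at x within D)"
  shows "regular_subgradient f D x v"
  unfolding regular_subgradient_def
proof (intro allI impI)
  fix e :: real assume "0 < e"
  with assms have "\<forall>\<^sub>F y in at x within D. norm (f y - f x - v (y - x)) \<le> e * norm (y - x)"
    by (auto simp: has_derivative_within_alt2)
  then show "\<forall>\<^sub>F y in at x within D. f x + v (y - x) - e * norm (y - x) \<le> f y"
    by eventually_elim (auto simp: abs_le_iff)
qed

lemma regular_subgradient_add:
  assumes "regular_subgradient f D x v" "regular_subgradient g D x w"
  shows "regular_subgradient (\<lambda>y. f y + g y) D x (\<lambda>d. v d + w d)"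
  unfolding regular_subgradient_def
proof (intro allI impI)
  fix e :: real assume "0 < e"
  with assms have "\<forall>\<^sub>F y in at x within D. f x + v (y - x) - (e/2) * norm (y - x) \<le> f y"
    "\<forall>\<^sub>F y in at x within D. g x + w (y - x) - (e/2) * norm (y - x) \<le> g y"
    unfolding regular_subgradient_def by (meson half_gt_zero)+
  then show "\<forall>\<^sub>F y in at x within D.
      f x + g x + (v (y - x) + w (y - x)) - e * norm (y - x) \<le> f y + g y"
    by eventually_elim (simp add: algebra_simps)
qed

lemma regular_subgradient_sum:
  assumes "finite A" "\<And>i. i \<in> A \<Longrightarrow> regular_subgradient (f i) D x (v i)"
  shows "regular_subgradient (\<lambda>y. \<Sum>i\<in>A. f i y) D x (\<lambda>d. \<Sum>i\<in>A. v i d)"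
  using assms
proof (induction rule: finite_induct)
  case empty
  show ?case by (rule regular_subgradient_affine_minorant) simp
next
  case (insert i A)
  then show ?case by (simp add: regular_subgradient_add)
qed

text \<open>The linear functional \<open>v\<close> turns the first-order expansion of
  \<open>G\<close> into one of \<open>v\<close> composed with \<open>G\<close>, and near
  \<open>x\<close> the error in the inner variable is at most proportional to
  \<open>norm (y - x)\<close>.\<close>

lemma regular_subgradient_compose:
  fixes G :: "'a::real_normed_vector \<Rightarrow> 'b::real_normed_vector"
  assumes g: "regular_subgradient g UNIV (G x) v" and v: "bounded_linear v"
    and G: "(G has_derivative G') (at x within D)"
  shows "regular_subgradient (\<lambda>y. g (G y)) D x (\<lambda>d. v (G' d))"
  unfolding regular_subgradient_def
proof (intro allI impI)
  fix e :: real assume e: "0 < e"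
  obtain B where B: "0 < B" "\<And>d. norm (G' d) \<le> B * norm d"
    using bounded_linear.pos_bounded[OF has_derivative_bounded_linear[OF G]]
    by (auto simp: mult.commute)
  \<comment> \<open>Near \<open>x\<close> the increment of \<open>G\<close> is at most
    \<open>(B + 1) * norm (y - x)\<close>, so the error of \<open>g\<close> costs half of
    \<open>e\<close>; the other half pays for expanding \<open>G\<close>.\<close>
  define e' where "e' = e / (2 * (B + 1))"
  have e': "0 < e'" using e B by (simp add: e'_def)
  have "\<forall>\<^sub>F z in nhds (G x). g (G x) + v (z - G x) - e' * norm (z - G x) \<le> g z"
    using g e' linear_0[OF bounded_linear.linear[OF v]]
    unfolding regular_subgradient_def by (auto simp: eventually_nhds_conv_at)
  moreover have "(G \<longlongrightarrow> G x) (at x within D)"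
    using has_derivative_continuous[OF G] by (simp add: continuous_within)
  ultimately have
    1: "\<forall>\<^sub>F y in at x within D. g (G x) + v (G y - G x) - e' * norm (G y - G x) \<le> g (G y)"
    by (rule eventually_compose_filterlim)
  have 2: "\<forall>\<^sub>F y in at x within D. norm (G y - G x - G' (y - x)) \<le> 1 * norm (y - x)"
    using G unfolding has_derivative_within_alt2 by (metis zero_less_one)
  have "((\<lambda>y. v (G y)) has_derivative (\<lambda>d. v (G' d))) (at x within D)"
    by (rule bounded_linear.has_derivative[OF v G])
  then have "\<forall>\<^sub>F y in at x within D. norm (v (G y) - v (G x) - v (G' (y - x))) \<le> e / 2 * norm (y - x)"
    using e unfolding has_derivative_within_alt2 by (meson half_gt_zero)
  with 1 2 show "\<forall>\<^sub>F y in at x within D. g (G x) + v (G' (y - x)) - e * norm (y - x) \<le> g (G y)"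
  proof eventually_elim
    case (elim y)
    have v_ge: "v (G' (y - x)) - e / 2 * norm (y - x) \<le> v (G y) - v (G x)"
      using elim(3) unfolding real_norm_def abs_le_iff by linarith
    have "norm (G y - G x) \<le> norm (G' (y - x)) + norm (G y - G x - G' (y - x))"
      by (metis add.commute diff_add_cancel norm_triangle_ineq)
    also have "\<dots> \<le> (B + 1) * norm (y - x)"
      using B(2)[of "y - x"] elim(2) by (simp add: algebra_simps)
    finally have "e' * norm (G y - G x) \<le> e' * ((B + 1) * norm (y - x))"
      using e' by (intro mult_left_mono) auto
    also have "\<dots> = e / 2 * norm (y - x)" using B by (simp add: e'_def field_simps)
    finally have "e' * norm (G y - G x) \<le> e / 2 * norm (y - x)" .
    moreover have "v (G y - G x) = v (G y) - v (G x)"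
      by (rule linear_diff[OF bounded_linear.linear[OF v]])
    ultimately show ?case using elim(1) v_ge by argo
  qed
qed

text \<open>Passes from the real-valued form to the difference quotients of \<open>f\<close>.
  Outside \<open>D\<close> these quotients are \<infinity>, so only approach within \<open>D\<close>
  matters for the lower limit.\<close>

lemma regular_subdiffI:
  fixes f :: "'a::euclidean_space \<Rightarrow> ereal"
  assumes x: "x \<in> D" and D: "\<And>y. y \<in> D \<Longrightarrow> f y = ereal (g y)" and nD: "\<And>y. y \<notin> D \<Longrightarrow> f y = \<infinity>"
    and v: "regular_subgradient g D x (\<lambda>d. v \<bullet> d)"
  shows "v \<in> regular_subdiff f x"
proof -
  have "\<forall>\<^sub>F y in at x. c < (f y - f x - ereal (v \<bullet> (y - x))) / ereal (norm (y - x))"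
    if c: "c < 0" for c :: ereal
  proof -
    obtain e where e: "0 < e" "c < ereal (- e)"
    proof -
      obtain s where "c < ereal s" "ereal s < 0" using c ereal_dense2 by blast
      then show thesis using that[of "- s"] by auto
    qed
    have "\<forall>\<^sub>F y in at x within D. g x + v \<bullet> (y - x) - e * norm (y - x) \<le> g y"
      using v e unfolding regular_subgradient_def by blast
    then have "\<forall>\<^sub>F y in at x. y \<in> D \<longrightarrow> g x + v \<bullet> (y - x) - e * norm (y - x) \<le> g y"
      unfolding eventually_at_filter by eventually_elim auto
    moreover have "\<forall>\<^sub>F y in at x. y \<noteq> x" by (auto simp: eventually_at_filter)
    ultimately show ?thesis
    proof eventually_elim
      case (elim y)
      show ?case
      proof (cases "y \<in> D")
        case True
        then have "- e \<le> (g y - g x - v \<bullet> (y - x)) / norm (y - x)"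
          using elim by (simp add: field_simps)
        then have "c < ereal ((g y - g x - v \<bullet> (y - x)) / norm (y - x))"
          using e(2) by (meson ereal_less_eq(3) order_less_le_trans)
        then show ?thesis using True x elim by (simp add: D)
      next
        case False
        then show ?thesis using x c elim by (simp add: D nD ereal_divide_eq) (use c in auto)
      qed
    qed
  qed
  then have "0 \<le> Liminf (at x) (\<lambda>y. (f y - f x - ereal (v \<bullet> (y - x))) / ereal (norm (y - x)))"
    by (auto simp: le_Liminf_iff)
  then show ?thesis using x by (simp add: regular_subdiff_def D)
qed

lemma regular_subdiff_subset_limiting: "regular_subdiff f x \<subseteq> limiting_subdiff f x"
proof
  fix v assume v: "v \<in> regular_subdiff f x"
  show "v \<in> limiting_subdiff f x"
    unfolding limiting_subdiff_def
    by (intro CollectI conjI exI[of _ "\<lambda>_. x"] exI[of _ "\<lambda>_. v"])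
      (use v in \<open>auto simp: regular_subdiff_def\<close>)
qed

lemma linear_functional_inner:
  fixes \<phi> :: "'a::euclidean_space \<Rightarrow> real"
  assumes "linear \<phi>"
  obtains v where "\<phi> = (\<lambda>d. v \<bullet> d)"
proof
  show "\<phi> = (\<lambda>d. adjoint \<phi> 1 \<bullet> d)"
    using adjoint_works[OF assms, of _ 1] by (simp add: fun_eq_iff inner_commute)
qed

text \<open>By the product rule, the derivative of \<open>G z\<close> in \<open>z\<close> cancels
  against the one coming from \<open>- z\<close> in the increment. The remaining dependence on
  \<open>z\<close> carries the factor \<open>a - b\<close>, which makes it small when the
  linearisation is evaluated near its base point.\<close>

lemma linearization_has_derivative:
  fixes G :: "'a::euclidean_space \<Rightarrow> 'b::euclidean_space" and G' :: "'a \<Rightarrow> 'a \<Rightarrow>\<^sub>L 'b"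
  assumes G: "(G has_derivative G' b) (at b)" and G': "(G' has_derivative G'') (at b)"
  shows "((\<lambda>p. G (fst (snd p)) + G' (fst (snd p)) (fst p - fst (snd p))) has_derivative
      (\<lambda>d. G' b (fst d) + G'' (fst (snd d)) (a - b))) (at (a, b, t::real) within S)"
proof -
  let ?p = "(a, b, t)"
  have b: "((\<lambda>p. fst (snd p)) has_derivative (\<lambda>d. fst (snd d))) (at ?p within S)"
    by (intro derivative_intros)
  have 1: "((\<lambda>p. G (fst (snd p))) has_derivative (\<lambda>d. G' b (fst (snd d)))) (at ?p within S)"
    by (rule has_derivative_compose[OF b]) (use G in simp)
  have 2: "((\<lambda>p. G' (fst (snd p))) has_derivative (\<lambda>d. G'' (fst (snd d)))) (at ?p within S)"
    by (rule has_derivative_compose[OF b]) (use G' in simp)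
  have 3: "((\<lambda>p. fst p - fst (snd p)) has_derivative (\<lambda>d. fst d - fst (snd d))) (at ?p within S)"
    by (intro derivative_intros)
  from has_derivative_add[OF 1 blinfun.FDERIV[OF 2 3]] show ?thesis by (simp add: blinfun.diff_right)
qed

section \<open>Matrices and the entrywise absolute value\<close>

lemma abs_nth_nth: "\<bar>y\<bar> $ i $ j = \<bar>(y::real^'n^'m) $ i $ j\<bar>"
  by (simp add: abs_vec_def)

lemma inner_matrix: "a \<bullet> b = (\<Sum>i\<in>UNIV. \<Sum>j\<in>UNIV. a $ i $ j * (b::real^'n^'m) $ i $ j)"
  by (simp add: inner_vec_def)

lemma nth_nth_le_norm: "\<bar>(y::real^'n^'m) $ i $ j\<bar> \<le> norm y"
  using component_le_norm_cart[of "y $ i" j] Finite_Cartesian_Product.norm_nth_le[of y i] by linarith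

lemma sum_square_nth_nth: "(\<Sum>i\<in>UNIV. \<Sum>j\<in>UNIV. ((y::real^'n^'m) $ i $ j)\<^sup>2) = (norm y)\<^sup>2"
  unfolding power2_norm_eq_inner inner_matrix by (simp add: power2_eq_square)

lemma norm_le_entrywise:
  fixes a b :: "real^'n^'m"
  assumes "\<And>i j. \<bar>a $ i $ j\<bar> \<le> L * \<bar>b $ i $ j\<bar>" and "0 \<le> L"
  shows "norm a \<le> L * norm b"
proof (rule power2_le_imp_le)
  have "(norm a)\<^sup>2 \<le> (\<Sum>i\<in>UNIV. \<Sum>j\<in>UNIV. (L * b $ i $ j)\<^sup>2)"
    unfolding sum_square_nth_nth[symmetric]
    using assms by (intro sum_mono) (simp add: abs_le_square_iff[symmetric] abs_mult)
  also have "\<dots> = (L * norm b)\<^sup>2"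
    by (simp add: power_mult_distrib sum_square_nth_nth flip: sum_distrib_left)
  finally show "(norm a)\<^sup>2 \<le> (L * norm b)\<^sup>2" .
qed (use assms in simp)

text \<open>Both sides amount to \<open>|\<sigma>| \<le> 1\<close> together with
  \<open>\<sigma> * r = |r|\<close>; the inequality reveals this at the test points
  \<open>r + 1\<close>, \<open>r - 1\<close>, \<open>0\<close> and \<open>2 * r\<close>.\<close>

lemma abs_subdiff_iff: "\<sigma> \<in> abs_subdiff r \<longleftrightarrow> (\<forall>s. \<bar>r\<bar> + \<sigma> * (s - r) \<le> \<bar>s\<bar>)"
proof
  assume "\<sigma> \<in> abs_subdiff r"
  then have \<sigma>: "\<bar>\<sigma>\<bar> \<le> 1" "\<sigma> * r = \<bar>r\<bar>"
    by (auto simp: abs_subdiff_def sgn_if split: if_splits)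
  have "\<sigma> * s \<le> \<bar>s\<bar>" for s
  proof -
    have "\<sigma> * s \<le> \<bar>\<sigma>\<bar> * \<bar>s\<bar>" by (metis abs_ge_self abs_mult)
    also have "\<dots> \<le> 1 * \<bar>s\<bar>" using \<sigma> by (intro mult_right_mono) auto
    finally show ?thesis by simp
  qed
  then show "\<forall>s. \<bar>r\<bar> + \<sigma> * (s - r) \<le> \<bar>s\<bar>" using \<sigma> by (simp add: right_diff_distrib)
next
  assume *: "\<forall>s. \<bar>r\<bar> + \<sigma> * (s - r) \<le> \<bar>s\<bar>"
  have "\<sigma> \<le> 1" "-1 \<le> \<sigma>" using *[rule_format, of "r + 1"] *[rule_format, of "r - 1"] by auto
  moreover have "\<sigma> * r = \<bar>r\<bar>"
    using *[rule_format, of 0] *[rule_format, of "2 * r"] by (auto simp: abs_mult)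
  then have "(\<sigma> - sgn r) * r = 0" by (simp add: left_diff_distrib abs_sgn mult.commute)
  ultimately show "\<sigma> \<in> abs_subdiff r" by (auto simp: abs_subdiff_def)
qed

lemma abs_subdiff_bounded: "\<sigma> \<in> abs_subdiff r \<Longrightarrow> \<bar>\<sigma>\<bar> \<le> 1"
  by (auto simp: abs_subdiff_def sgn_if split: if_splits)

text \<open>Changing a single entry of \<open>y\<close> decouples the inequality, which is then
  divided by the weight. A zero weight forces the entry of \<open>w\<close> to vanish, and any
  admissible sign will do. The signs are returned separately from the weights because they are later
  combined with other weights.\<close>

lemma subgradient_weighted_l1:
  fixes c w y :: "real^'n^'m"
  assumes c: "\<And>i j. 0 \<le> c $ i $ j"
    and w: "\<And>z. c \<bullet> \<bar>y\<bar> + w \<bullet> (z - y) \<le> c \<bullet> \<bar>z\<bar>"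
  obtains \<sigma> where "\<And>i j. \<sigma> i j \<in> abs_subdiff (y $ i $ j)" "\<And>i j. w $ i $ j = c $ i $ j * \<sigma> i j"
proof -
  have "\<exists>\<sigma>. \<sigma> \<in> abs_subdiff (y $ i $ j) \<and> w $ i $ j = c $ i $ j * \<sigma>" for i j
  proof -
    define r where "r = y $ i $ j"
    have *: "c $ i $ j * \<bar>r\<bar> + w $ i $ j * (s - r) \<le> c $ i $ j * \<bar>s\<bar>" for s
    proof -
      define z where "z = y + axis i (axis j (s - r))"
      have "\<bar>z\<bar> - \<bar>y\<bar> = axis i (axis j (\<bar>s\<bar> - \<bar>r\<bar>))"
        by (auto simp: vec_eq_iff abs_nth_nth z_def axis_def r_def)
      then have "c \<bullet> (\<bar>z\<bar> - \<bar>y\<bar>) = c $ i $ j * (\<bar>s\<bar> - \<bar>r\<bar>)"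
        by (simp add: inner_axis)
      moreover have "w \<bullet> (z - y) = w $ i $ j * (s - r)"
        by (simp add: z_def inner_axis)
      ultimately show ?thesis using w[of z] by (simp add: inner_diff_right right_diff_distrib)
    qed
    show ?thesis
    proof (cases "c $ i $ j = 0")
      case True
      then have "w $ i $ j * 1 \<le> 0" "w $ i $ j * (- 1) \<le> 0" using *[of "r + 1"] *[of "r - 1"] by auto
      then have "w $ i $ j = 0" by simp
      then show ?thesis using True by (intro exI[of _ "sgn r"]) (auto simp: abs_subdiff_def r_def)
    next
      case False
      then have "0 < c $ i $ j" using c[of i j] by simp
      then have "\<bar>r\<bar> + w $ i $ j / c $ i $ j * (s - r) \<le> \<bar>s\<bar>" for s
        using *[of s] by (simp add: field_simps)
      then show ?thesis
        using False by (intro exI[of _ "w $ i $ j / c $ i $ j"]) (auto simp: abs_subdiff_iff r_def)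
    qed
  qed
  then show thesis using that by metis
qed

lemma convex_on_weighted_l1:
  fixes c :: "real^'n^'m"
  assumes "\<And>i j. 0 \<le> c $ i $ j"
  shows "convex_on UNIV (\<lambda>y. c \<bullet> \<bar>y\<bar>)"
proof (rule convex_onI)
  fix t :: real and y z :: "real^'n^'m" assume t: "0 < t" "t < 1"
  have "c $ i $ j * \<bar>(1 - t) * y $ i $ j + t * z $ i $ j\<bar>
      \<le> (1 - t) * (c $ i $ j * \<bar>y $ i $ j\<bar>) + t * (c $ i $ j * \<bar>z $ i $ j\<bar>)" for i j
  proof -
    have "\<bar>(1 - t) * y $ i $ j + t * z $ i $ j\<bar> \<le> (1 - t) * \<bar>y $ i $ j\<bar> + t * \<bar>z $ i $ j\<bar>"
      using t abs_triangle_ineq[of "(1 - t) * y $ i $ j" "t * z $ i $ j"] by (simp add: abs_mult)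
    from mult_left_mono[OF this assms[of i j]] show ?thesis by (simp add: algebra_simps)
  qed
  then show "c \<bullet> \<bar>(1 - t) *\<^sub>R y + t *\<^sub>R z\<bar> \<le> (1 - t) * (c \<bullet> \<bar>y\<bar>) + t * (c \<bullet> \<bar>z\<bar>)"
    unfolding inner_matrix abs_nth_nth sum_distrib_left
    by (simp add: sum_mono flip: sum.distrib)
qed auto

lemma tendsto_abs_matrix:
  fixes f :: "'b \<Rightarrow> real^'n^'m"
  assumes "(f \<longlongrightarrow> l) G" shows "((\<lambda>k. \<bar>f k\<bar>) \<longlongrightarrow> \<bar>l\<bar>) G"
  unfolding abs_vec_def by (intro tendsto_vec_lambda tendsto_intros tendsto_vec_nth assms)

section \<open>Finite length from the KL inequality\<close>

lemma Upsilon_tangent: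
  assumes \<phi>: "\<phi> \<in> Upsilon \<eta>" and s: "0 < s" "ereal s < \<eta>" and t: "0 \<le> t" "ereal t < \<eta>"
  shows "\<phi> t \<le> \<phi> s + deriv \<phi> s * (t - s)"
proof (rule concave_on_tangent)
  show c: "concave_on {t. 0 \<le> t \<and> ereal t < \<eta>} \<phi>" using \<phi> by (simp add: Upsilon_def)
  then show "connected {t. 0 \<le> t \<and> ereal t < \<eta>}"
    by (auto simp: concave_on_def convex_on_def convex_connected)
  have "open {t. 0 < t \<and> ereal t < \<eta>}"
    by (intro open_Collect_conj open_Collect_less continuous_intros)
  then show "s \<in> interior {t. 0 \<le> t \<and> ereal t < \<eta>}"
    using s by (intro interiorI[of "{t. 0 < t \<and> ereal t < \<eta>}"]) auto
qed (use \<phi> s t in \<open>auto simp: Upsilon_def\<close>)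

lemma Upsilon_deriv_antimono:
  assumes \<phi>: "\<phi> \<in> Upsilon \<eta>" and s: "0 < s" "s \<le> t" "ereal t < \<eta>"
  shows "deriv \<phi> t \<le> deriv \<phi> s"
proof (cases "s = t")
  case False
  have s': "ereal s < \<eta>" using s by (meson ereal_less_eq(3) order_le_less_trans)
  have "\<phi> t \<le> \<phi> s + deriv \<phi> s * (t - s)" "\<phi> s \<le> \<phi> t + deriv \<phi> t * (s - t)"
    using s s' by (auto intro!: Upsilon_tangent[OF \<phi>])
  then have "deriv \<phi> t * (t - s) \<le> deriv \<phi> s * (t - s)" by (simp add: algebra_simps)
  then show ?thesis using False s by simp
qed simp

lemma Upsilon_tendsto_0:
  assumes \<phi>: "\<phi> \<in> Upsilon \<eta>" and "0 < \<eta>" and D: "D \<longlonglongrightarrow> 0"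
    "\<forall>\<^sub>F k in sequentially. 0 \<le> D k \<and> ereal (D k) < \<eta>"
  shows "(\<lambda>k. \<phi> (D k)) \<longlonglongrightarrow> 0"
proof -
  have "continuous_on {t. 0 \<le> t \<and> ereal t < \<eta>} \<phi>" "\<phi> 0 = 0" using \<phi> by (auto simp: Upsilon_def)
  with continuous_on_tendsto_compose[OF this(1) D(1)] D(2) assms(2) show ?thesis
    by (simp add: zero_ereal_def)
qed

text \<open>The KL inequality is only assumed near a cluster point; the bound on the partial sums keeps the
  sequence there.\<close>

lemma KL_finite_length:
  fixes x :: "nat \<Rightarrow> 'a::real_normed_vector"
  assumes \<phi>: "\<phi> \<in> Upsilon \<eta>" and \<eta>: "0 < \<eta>"
    and D: "D \<longlonglongrightarrow> 0" "\<And>k. 0 < D k" and small: "\<And>k. k \<ge> m \<Longrightarrow> ereal (D k) < \<eta>"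
    and b: "\<And>k. 0 \<le> b k" "\<And>k. (b k)\<^sup>2 \<le> D k - D (Suc k)"
    and step: "\<And>k. norm (x (Suc k) - x k) \<le> c * b k" "0 \<le> c"
    and s: "strict_mono s" "(x \<circ> s) \<longlonglongrightarrow> xs"
    and KL: "\<And>k. \<lbrakk>k \<ge> m; norm (x k - xs) < \<delta>\<rbrakk> \<Longrightarrow> 1 \<le> C * deriv \<phi> (D (Suc k)) * b k"
    and \<delta>: "0 < \<delta>" and C: "0 \<le> C"
  shows "summable b"
proof -
  define P where "P k = \<phi> (D k)" for k
  have P_nonneg: "0 \<le> P k" if "k \<ge> m" for k
    using \<phi> small[OF that] D(2)[of k] by (auto simp: P_def Upsilon_def)
  have "P \<longlonglongrightarrow> 0"
    unfolding P_def
    by (rule Upsilon_tendsto_0[OF \<phi> \<eta> D(1)])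
      (use small D(2) in \<open>auto simp: eventually_sequentially less_imp_le intro!: exI[of _ m]\<close>)
  then have P1: "(\<lambda>k. P (Suc k)) \<longlonglongrightarrow> 0" by (rule LIMSEQ_Suc)
  have "(\<lambda>k. (b k)\<^sup>2) \<longlonglongrightarrow> 0"
  proof (rule tendsto_sandwich)
    show "(\<lambda>_. 0) \<longlonglongrightarrow> (0::real)" by simp
    show "(\<lambda>k. D k - D (Suc k)) \<longlonglongrightarrow> 0"
      using tendsto_diff[OF D(1) LIMSEQ_Suc[OF D(1)]] by simp
  qed (use b in auto)
  then have b0: "b \<longlonglongrightarrow> 0" using tendsto_real_sqrt[of "\<lambda>k. (b k)\<^sup>2" 0] b(1) by simp
  \<comment> \<open>The KL inequality at \<open>k\<close> bounds the slope of \<open>\<phi>\<close>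
    at \<open>D (Suc k)\<close>, so it is paired with the following decrease
    \<open>\<Delta>\<close>, which dominates the square of \<open>b (Suc k)\<close>. By concavity,
    slope times decrease is at most the drop of \<open>P\<close>; the product \<open>b k * a\<close>
    is then split by the arithmetic-geometric mean inequality.\<close>
  have key: "2 * b (Suc k) \<le> b k + C * (P (Suc k) - P (Suc (Suc k)))"
    if k: "k \<ge> m" "norm (x k - xs) < \<delta>" for k
  proof -
    define d where "d = deriv \<phi> (D (Suc k))"
    define \<Delta> where "\<Delta> = D (Suc k) - D (Suc (Suc k))"
    have d: "0 < d" using \<phi> small[of "Suc k"] D(2)[of "Suc k"] k by (auto simp: Upsilon_def d_def)
    have "P (Suc (Suc k)) \<le> P (Suc k) + d * (D (Suc (Suc k)) - D (Suc k))"
      unfolding P_def d_def using small k D(2)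
      by (intro Upsilon_tangent[OF \<phi>]) (auto simp: less_imp_le)
    then have \<Delta>: "d * \<Delta> \<le> P (Suc k) - P (Suc (Suc k))" by (simp add: \<Delta>_def algebra_simps)
    have "0 \<le> (b (Suc k))\<^sup>2" by simp
    then have \<Delta>0: "0 \<le> \<Delta>" using b(2)[of "Suc k"] unfolding \<Delta>_def by linarith
    define a where "a = C * (P (Suc k) - P (Suc (Suc k)))"
    have "0 \<le> d * \<Delta>" using \<Delta>0 d by simp
    then have a: "0 \<le> a" using \<Delta> C by (simp add: a_def)
    have "(b (Suc k))\<^sup>2 \<le> 1 * \<Delta>" using b(2)[of "Suc k"] by (simp add: \<Delta>_def)
    also have "\<dots> \<le> (C * d * b k) * \<Delta>" using KL[OF k] \<Delta>0 unfolding d_def by (intro mult_right_mono)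
    also have "\<dots> = b k * (C * (d * \<Delta>))" by simp
    also have "\<dots> \<le> b k * a"
      unfolding a_def using \<Delta> C b(1) by (intro mult_left_mono) auto
    finally have "4 * (b (Suc k))\<^sup>2 \<le> 4 * (b k * a)" by simp
    also have "\<dots> = (b k + a)\<^sup>2 - (b k - a)\<^sup>2" by (simp add: power2_eq_square algebra_simps)
    also have "\<dots> \<le> (b k + a)\<^sup>2" by simp
    finally have "(2 * b (Suc k))\<^sup>2 \<le> (b k + a)\<^sup>2" by (simp add: power_mult_distrib)
    then show ?thesis using a b(1)[of k] unfolding a_def by (auto intro: power2_le_imp_le)
  qed
  \<comment> \<open>The last condition is a length budget: the tail starting at \<open>K\<close>
    will travel at most this far, so from within \<open>\<delta> / 2\<close> of \<open>xs\<close> it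
    cannot leave the ball where the KL inequality is available.\<close>
  obtain K where K: "K \<ge> m" "norm (x K - xs) < \<delta> / 2" "c * (2 * b K + C * P (Suc K)) < \<delta> / 2"
  proof -
    have "(\<lambda>k. c * (2 * b k + C * P (Suc k))) \<longlonglongrightarrow> c * (2 * 0 + C * 0)"
      by (intro tendsto_intros b0 P1)
    then have "\<forall>\<^sub>F k in sequentially. c * (2 * b k + C * P (Suc k)) < \<delta> / 2"
      by (rule order_tendstoD(2)) (use \<delta> in simp)
    then obtain N where N: "\<And>k. k \<ge> N \<Longrightarrow> c * (2 * b k + C * P (Suc k)) < \<delta> / 2"
      by (auto simp: eventually_sequentially)
    have "\<forall>\<^sub>F i in sequentially. dist ((x \<circ> s) i) xs < \<delta> / 2"
      using tendstoD[OF s(2), of "\<delta> / 2"] \<delta> by simp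
    then obtain M where M: "\<And>i. i \<ge> M \<Longrightarrow> dist (x (s i)) xs < \<delta> / 2"
      by (auto simp: eventually_sequentially)
    define i where "i = max M (max N m)"
    have "i \<ge> max N m" "dist (x (s i)) xs < \<delta> / 2" using M[of i] by (auto simp: i_def)
    moreover have "s i \<ge> i" using s(1) by (rule seq_suble)
    ultimately show thesis using N[of "s i"] by (intro that[of "s i"]) (auto simp: dist_norm)
  qed
  define S where "S n = (\<Sum>i<n. b (Suc (K + i)))" for n
  have dist_le: "norm (x (K + Suc n) - xs) \<le> norm (x K - xs) + c * (b K + S n)" for n
  proof (induction n)
    case 0
    have "norm (x (Suc K) - xs) \<le> norm (x (Suc K) - x K) + norm (x K - xs)"
      using norm_triangle_ineq[of "x (Suc K) - x K" "x K - xs"] by simp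
    then show ?case using step(1)[of K] by (simp add: S_def)
  next
    case (Suc n)
    have "norm (x (K + Suc (Suc n)) - xs)
        \<le> norm (x (K + Suc (Suc n)) - x (K + Suc n)) + norm (x (K + Suc n) - xs)"
      using norm_triangle_ineq[of "x (K + Suc (Suc n)) - x (K + Suc n)" "x (K + Suc n) - xs"] by simp
    then show ?case using Suc step(1)[of "K + Suc n"] by (simp add: S_def algebra_simps)
  qed
  \<comment> \<open>The terms in \<open>b\<close> and \<open>P\<close> on the left make the
    recursion of \<open>key\<close> telescope. Closeness belongs to the same induction:
    \<open>key\<close> at \<open>K + n\<close> requires it, while closeness of the next iterate
    follows from the bound on \<open>S n\<close> alone.\<close>
  have inv: "S n + b (K + n) + C * P (Suc (K + n)) \<le> b K + C * P (Suc K) \<and> norm (x (K + n) - xs) < \<delta>" for n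
  proof (induction n)
    case 0
    then show ?case using K \<delta> by (simp add: S_def)
  next
    case (Suc n)
    have "2 * b (Suc (K + n)) \<le> b (K + n) + C * (P (Suc (K + n)) - P (Suc (Suc (K + n))))"
      using Suc K(1) by (intro key) auto
    then have 1: "S (Suc n) + b (K + Suc n) + C * P (Suc (K + Suc n)) \<le> b K + C * P (Suc K)"
      using Suc by (simp add: S_def algebra_simps)
    have "0 \<le> C * P (Suc (K + n))" using C P_nonneg K(1) by simp
    then have "b K + S n \<le> 2 * b K + C * P (Suc K)" using Suc b(1)[of "K + n"] by linarith
    then have "c * (b K + S n) \<le> c * (2 * b K + C * P (Suc K))"
      using step(2) by (rule mult_left_mono)
    then show ?case using 1 dist_le[of n] K(2,3) by simp
  qed
  have "summable (\<lambda>i. b (Suc (K + i)))"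
  proof (rule summableI_nonneg_bounded)
    show "(\<Sum>i<n. b (Suc (K + i))) \<le> b K + C * P (Suc K)" for n
    proof -
      have "0 \<le> C * P (Suc (K + n))" using C P_nonneg K(1) by simp
      then show ?thesis using inv[of n] b(1)[of "K + n"] unfolding S_def by linarith
    qed
  qed (rule b)
  then show ?thesis
    using summable_iff_shift[of b "Suc K"] by (simp add: add.commute)
qed

lemma summable_steps_convergent:
  fixes x :: "nat \<Rightarrow> 'a::banach"
  assumes "summable (\<lambda>k. norm (x (Suc k) - x k))"
  shows "convergent x"
proof -
  have "summable (\<lambda>k. x (Suc k) - x k)" using assms by (rule summable_norm_cancel)
  then have "(\<lambda>n. \<Sum>k<n. x (Suc k) - x k) \<longlonglongrightarrow> (\<Sum>k. x (Suc k) - x k)"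
    by (rule summable_LIMSEQ)
  then have "(\<lambda>n. x n - x 0 + x 0) \<longlonglongrightarrow> (\<Sum>k. x (Suc k) - x k) + x 0"
    unfolding sum_lessThan_telescope by (intro tendsto_intros)
  then show ?thesis by (auto simp: convergent_def)
qed

section \<open>The estimates along a run\<close>

text \<open>First and second derivatives are parameters of bounded linear type, so that their
  operator norms and continuity are at hand; on \<open>U\<close> the first ones agree with
  \<open>frechet_derivative\<close>, which the definitions use.\<close>

locale iPMM_C2 =
  fixes h :: "'a::euclidean_space \<Rightarrow> ereal"
    and U :: "'a set"
    and F :: "'a \<Rightarrow> real^'n^'m"
    and T :: "'a \<Rightarrow> real^'q^'p"
    and \<psi> :: "real^'q^'p \<Rightarrow> real"
    and I :: "real set"
    and \<theta> :: "real \<Rightarrow> real"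
    and \<nu> lam \<rho> \<gamma>lo \<gamma>hi \<mu>max \<gamma>tilde :: real
    and \<mu> :: "nat \<Rightarrow> real"
    and x :: "nat \<Rightarrow> 'a"
    and \<gamma> :: "nat \<Rightarrow> nat \<Rightarrow> real"
    and Q :: "nat \<Rightarrow> nat \<Rightarrow> 'a \<Rightarrow> 'a"
    and xin xb :: "nat \<Rightarrow> nat \<Rightarrow> 'a"
    and jj :: "nat \<Rightarrow> nat"
    and F' :: "'a \<Rightarrow> 'a \<Rightarrow>\<^sub>L (real^'n^'m)" and F'' :: "'a \<Rightarrow> 'a \<Rightarrow>\<^sub>L ('a \<Rightarrow>\<^sub>L (real^'n^'m))"
    and T' :: "'a \<Rightarrow> 'a \<Rightarrow>\<^sub>L (real^'q^'p)" and T'' :: "'a \<Rightarrow> 'a \<Rightarrow>\<^sub>L ('a \<Rightarrow>\<^sub>L (real^'q^'p))"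
  assumes std: "standing_assumption h U F T \<psi> I \<theta>"
    and \<nu>: "0 < \<nu>" and lam: "0 < lam"
    and run: "iPMM_run h F T \<psi> \<theta> \<nu> lam \<rho> \<gamma>lo \<gamma>hi \<mu>max \<mu> x \<gamma> Q xin xb jj"
    and bounded_x: "bounded (range x)"
    and F': "\<And>z. z \<in> U \<Longrightarrow> (F has_derivative F' z) (at z)"
    and F'': "\<And>z. z \<in> U \<Longrightarrow> (F' has_derivative F'' z) (at z)" "continuous_on U F''"
    and T': "\<And>z. z \<in> U \<Longrightarrow> (T has_derivative T' z) (at z)"
    and T'': "\<And>z. z \<in> U \<Longrightarrow> (T' has_derivative T'' z) (at z)" "continuous_on U T''"
    and \<gamma>tilde: "0 < \<gamma>tilde" "\<And>k. \<gamma> k (jj k) \<le> \<gamma>tilde"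
begin

abbreviation "obj \<equiv> Theta h F T \<psi> \<theta> \<nu> lam"
abbreviation "q k \<equiv> Q k (jj k)"
abbreviation "y k \<equiv> xb k (jj k)"
abbreviation "c k \<equiv> grad_vartheta \<theta> \<bar>F (x k)\<bar>"
abbreviation "model k \<equiv> Theta_model h F T \<psi> \<theta> \<nu> lam (x k) (q k)"
abbreviation "lF z w \<equiv> F w + F' w (z - w)"
abbreviation "lT z w \<equiv> T w + T' w (z - w)"
text \<open>Keeps the arithmetic in the reals. Outside \<open>edom h\<close> the value is 0 by
  default and meaningless, so every use is tied to membership in \<open>edom h\<close>.\<close>

definition "hr z = real_of_ereal (h z)"
abbreviation "objr z \<equiv> vartheta \<theta> \<bar>F z\<bar> + \<nu> * \<psi> (T z) + lam * hr z"
abbreviation "cvx k z \<equiv> c k \<bullet> \<bar>lF z (x k)\<bar> + \<nu> * \<psi> (lT z (x k)) + lam * hr z"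
abbreviation "modelr k z \<equiv> cvx k z + 1/2 * ((z - x k) \<bullet> q k (z - x k))
  + (vartheta \<theta> \<bar>F (x k)\<bar> - c k \<bullet> \<bar>F (x k)\<bar>)"

section \<open>The standing assumption and the run in real-valued form\<close>

lemma lsc_h: "lsc h"
  and hr_lipschitz: "locally_lipschitz_on (edom h) hr"
  and convex_\<psi>: "convex_on UNIV \<psi>"
  and \<theta>_concave: "concave_on I \<theta>"
  and \<theta>'_lipschitz: "locally_lipschitz_on I (deriv \<theta>)"
  and \<theta>'_nonneg: "0 \<le> s \<Longrightarrow> 0 \<le> deriv \<theta> s" and \<theta>_0: "\<theta> 0 = 0"
  and I_nonneg: "{0..} \<subseteq> I" and open_I: "open I"
  using std unfolding standing_assumption_def hr_def[abs_def] by simp_all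

lemma dom_U: "z \<in> edom h \<Longrightarrow> z \<in> U"
  using std unfolding standing_assumption_def by blast

lemma convex_hr: "convex_on (edom h) hr"
  using std unfolding standing_assumption_def proper_fun_def hr_def[abs_def]
  by (intro convex_on_real_of_ereal) auto

lemma connected_I: "connected I"
  using std unfolding standing_assumption_def by (simp add: is_interval_connected)

lemma \<theta>_diff: "0 \<le> s \<Longrightarrow> \<theta> differentiable (at s)"
  using std I_nonneg unfolding standing_assumption_def by auto

lemma h_dom: "z \<in> edom h \<Longrightarrow> h z = ereal (hr z)"
proof -
  have "h z \<noteq> -\<infinity>" using std by (simp add: standing_assumption_def proper_fun_def)
  then show "z \<in> edom h \<Longrightarrow> h z = ereal (hr z)" by (cases "h z") (auto simp: edom_def hr_def)
qed

lemma h_not_dom: "z \<notin> edom h \<Longrightarrow> h z = \<infinity>"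
  by (auto simp: edom_def)

lemma h_bounded_below: obtains a where "\<And>z. ereal a \<le> h z"
  using std by (auto simp: standing_assumption_def)

lemma \<psi>_bounded_below: obtains a where "\<And>z. a \<le> \<psi> z"
  using std by (auto simp: standing_assumption_def)

lemma lin_at_F: "w \<in> U \<Longrightarrow> lin_at F z w = lF z w"
  and lin_at_T: "w \<in> U \<Longrightarrow> lin_at T z w = lT z w"
  using frechet_derivative_at[OF F'] frechet_derivative_at[OF T'] by (simp_all add: lin_at_def)

lemma obj_dom: "z \<in> edom h \<Longrightarrow> obj z = ereal (objr z)"
  by (simp add: Theta_def h_dom)

lemma obj_not_dom: "z \<notin> edom h \<Longrightarrow> obj z = \<infinity>"
  using lam by (simp add: Theta_def h_not_dom)

lemma q: "linear (q k)" "q k u \<bullet> v = u \<bullet> q k v" "0 \<le> v \<bullet> q k v"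
  "v \<bullet> q k v \<le> (\<rho> * \<gamma>tilde) * (norm v)\<^sup>2" "\<gamma>lo * (norm v)\<^sup>2 \<le> v \<bullet> q k v"
  and \<rho>: "1 < \<rho>" and \<gamma>lo: "0 < \<gamma>lo" and \<mu>: "0 < \<mu> k" "\<mu> k \<le> \<mu>max"
proof -
  show r: "1 < \<rho>" "0 < \<gamma>lo" "0 < \<mu> k" "\<mu> k \<le> \<mu>max" using run by (auto simp: iPMM_run_def)
  have Q: "PD_operator (q k)" "loewner_le (\<lambda>v. \<gamma> k (jj k) *\<^sub>R v) (q k)"
    "loewner_le (q k) (\<lambda>v. (\<rho> * \<gamma> k (jj k)) *\<^sub>R v)"
    using run by (auto simp: iPMM_run_def Let_def)
  show "linear (q k)" "q k u \<bullet> v = u \<bullet> q k v" using Q(1) by (auto simp: PD_operator_def)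
  show "0 \<le> v \<bullet> q k v"
    using Q(1) by (cases "v = 0") (auto simp: PD_operator_def less_imp_le)
  have "v \<bullet> q k v \<le> (\<rho> * \<gamma> k (jj k)) * (norm v)\<^sup>2"
    using Q(3) by (auto simp: loewner_le_def power2_norm_eq_inner)
  also have "\<dots> \<le> (\<rho> * \<gamma>tilde) * (norm v)\<^sup>2"
    using \<gamma>tilde r by (intro mult_right_mono mult_left_mono) auto
  finally show "v \<bullet> q k v \<le> (\<rho> * \<gamma>tilde) * (norm v)\<^sup>2" .
  \<comment> \<open>Backtracking multiplies by \<open>\<rho> > 1\<close>, so the lower bound imposed
    on \<open>\<gamma> k 0\<close> survives up to the accepted step.\<close>
  have "\<gamma>lo \<le> \<gamma> k j" if "j \<le> jj k" for j
    using that
  proof (induction j)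
    case 0
    then show ?case using run by (auto simp: iPMM_run_def Let_def)
  next
    case (Suc j)
    then have "\<gamma> k (Suc j) = \<rho> * \<gamma> k j" using run by (auto simp: iPMM_run_def Let_def)
    moreover have "1 * \<gamma> k j \<le> \<rho> * \<gamma> k j" using Suc r by (intro mult_right_mono) auto
    ultimately show ?case using Suc by simp
  qed
  then have "\<gamma>lo * (norm v)\<^sup>2 \<le> \<gamma> k (jj k) * (norm v)\<^sup>2" by (intro mult_right_mono) auto
  also have "\<dots> \<le> v \<bullet> q k v"
    using Q(2) by (auto simp: loewner_le_def power2_norm_eq_inner)
  finally show "\<gamma>lo * (norm v)\<^sup>2 \<le> v \<bullet> q k v" .
qed

lemma norm_q: "norm (q k v) \<le> \<rho> * \<gamma>tilde * norm v"
  using \<rho> \<gamma>tilde by (intro norm_selfadjoint_le q) simp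

lemma run_step:
  "is_arg_min (model k) (\<lambda>_. True) (y k)" "model k (x (Suc k)) < obj (x k)"
  "model k (x (Suc k)) - model k (y k) \<le> ereal (\<mu> k / 2) * (obj (x k) - model k (x (Suc k)))"
  "obj (x (Suc k)) \<le> model k (x (Suc k))"
  using run by (simp_all add: iPMM_run_def Let_def)

lemma x_dom: "x k \<in> edom h"
proof (cases k)
  case 0
  then show ?thesis using run by (simp add: iPMM_run_def)
next
  case (Suc j)
  have "obj (x k) < obj (x j)" using run_step[of j] Suc by (metis order_le_less_trans)
  then show ?thesis using obj_not_dom[of "x k"] by force
qed

lemmas x_U = dom_U[OF x_dom]

lemma model_dom: "z \<in> edom h \<Longrightarrow> model k z = ereal (modelr k z)"
  using q(3)[where k = k]
  by (simp add: Theta_model_def h_dom lin_at_F lin_at_T x_U Qnorm_def)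

lemma model_not_dom: "z \<notin> edom h \<Longrightarrow> model k z = \<infinity>"
  using lam by (simp add: Theta_model_def h_not_dom)

lemma modelr_x: "modelr k (x k) = objr (x k)"
  using linear_0[OF q(1)] by simp

lemma y_dom: "y k \<in> edom h"
proof (rule ccontr)
  assume "y k \<notin> edom h"
  then have "model k (x k) < model k (y k)" using x_dom by (simp add: model_not_dom model_dom)
  then show False using run_step(1)[of k] by (auto simp: is_arg_min_def)
qed

lemma y_min: "z \<in> edom h \<Longrightarrow> modelr k (y k) \<le> modelr k z"
proof -
  assume z: "z \<in> edom h"
  have "model k (y k) \<le> model k z"
    using run_step(1)[of k] by (auto simp: is_arg_min_def not_less)
  then show ?thesis by (simp add: model_dom y_dom z)
qed

definition "gap k = objr (x k) - modelr k (x (Suc k))"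

lemma gap_pos: "0 < gap k"
  using run_step(2)[of k] by (simp add: model_dom obj_dom x_dom gap_def)

lemma inexact: "modelr k (x (Suc k)) - modelr k (y k) \<le> \<mu>max / 2 * gap k"
proof -
  have "modelr k (x (Suc k)) - modelr k (y k) \<le> \<mu> k / 2 * gap k"
    using run_step(3)[of k] by (simp add: model_dom obj_dom x_dom y_dom gap_def)
  also have "\<dots> \<le> \<mu>max / 2 * gap k" using \<mu>[of k] gap_pos[of k] by (intro mult_right_mono) auto
  finally show ?thesis .
qed

lemma descent: "objr (x (Suc k)) \<le> objr (x k) - gap k"
  using run_step(4)[of k] by (simp add: model_dom obj_dom x_dom gap_def)

lemma \<theta>_tangent: "0 \<le> s \<Longrightarrow> 0 \<le> t \<Longrightarrow> \<theta> t \<le> \<theta> s + deriv \<theta> s * (t - s)"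
  using I_nonneg open_I
  by (intro concave_on_tangent[OF \<theta>_concave connected_I] \<theta>_diff) (auto simp: interior_open)

lemma \<theta>'_antimono: "0 \<le> s \<Longrightarrow> s \<le> t \<Longrightarrow> deriv \<theta> t \<le> deriv \<theta> s"
proof (cases "s = t")
  case False
  assume st: "0 \<le> s" "s \<le> t"
  then have "0 \<le> (deriv \<theta> s - deriv \<theta> t) * (t - s)"
    using \<theta>_tangent[of s t] \<theta>_tangent[of t s] by (simp add: algebra_simps)
  then show ?thesis using False st by (simp add: zero_le_mult_iff)
qed simp

lemma \<theta>_nonneg: "0 \<le> s \<Longrightarrow> 0 \<le> \<theta> s"
  using \<theta>_tangent[of s 0] \<theta>'_nonneg[of s] \<theta>_0 by (auto intro: order_trans[of 0 "deriv \<theta> s * s"])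

lemma vartheta_nonneg: "0 \<le> vartheta \<theta> \<bar>z\<bar>"
  unfolding vartheta_def by (intro sum_nonneg \<theta>_nonneg) (simp add: abs_nth_nth)

lemma c_nth: "c k $ i $ j = deriv \<theta> \<bar>F (x k) $ i $ j\<bar>"
  by (simp add: grad_vartheta_def abs_nth_nth)

lemma c_nonneg: "0 \<le> c k $ i $ j"
  by (simp add: c_nth \<theta>'_nonneg)

lemma affine_lF: "lF ((1 - u) *\<^sub>R a + u *\<^sub>R b) w = (1 - u) *\<^sub>R lF a w + u *\<^sub>R lF b w"
  and affine_lT: "lT ((1 - u) *\<^sub>R a + u *\<^sub>R b) w = (1 - u) *\<^sub>R lT a w + u *\<^sub>R lT b w"
  by (simp_all add: blinfun.add_right blinfun.diff_right blinfun.scaleR_right algebra_simps)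

section \<open>First-order optimality and quadratic growth at the exact minimizer\<close>

lemma convex_cvx: "convex_on (edom h) (cvx k)"
proof -
  have D: "convex (edom h)" using convex_hr by (simp add: convex_on_def)
  show ?thesis
    using \<nu> lam
    by (intro convex_on_add convex_on_cmul convex_hr less_imp_le
        convex_on_compose_affine[OF convex_on_weighted_l1[OF c_nonneg] D affine_lF]
        convex_on_compose_affine[OF convex_\<psi> D affine_lT])
qed

lemma variational_inequality:
  assumes "z \<in> edom h"
  shows "cvx k (y k) - q k (y k - x k) \<bullet> (z - y k) \<le> cvx k z"
proof (rule prox_minimizer_variational_inequality[OF convex_cvx q(1,2) y_dom assms])
  fix z assume "z \<in> edom h"
  from y_min[OF this, of k]
  show "cvx k (y k) + 1/2 * ((y k - x k) \<bullet> q k (y k - x k)) \<le> cvx k z + 1/2 * ((z - x k) \<bullet> q k (z - x k))"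
    by simp
qed

text \<open>The sum rule at \<open>y k\<close>, written as three global inequalities. The
  variational inequality replaces the proximal term by its linear part \<open>v\<close>, so
  \<open>y k\<close> minimizes a finite convex function of an affine map plus a convex function on
  \<open>edom h\<close>. Both linearisations are paired into the one map \<open>A\<close>, so that a
  single separation produces \<open>w1\<close> and \<open>w2\<close> together.\<close>

lemma optimality:
  obtains w1 w2
  where "\<And>z. c k \<bullet> \<bar>lF (y k) (x k)\<bar> + w1 \<bullet> (z - lF (y k) (x k)) \<le> c k \<bullet> \<bar>z\<bar>"
    and "\<And>z. \<nu> * \<psi> (lT (y k) (x k)) + w2 \<bullet> (z - lT (y k) (x k)) \<le> \<nu> * \<psi> z"
    and "\<And>z. z \<in> edom h \<Longrightarrow> lam * hr (y k) - w1 \<bullet> F' (x k) (z - y k) - w2 \<bullet> T' (x k) (z - y k)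
        - q k (y k - x k) \<bullet> (z - y k) \<le> lam * hr z"
proof -
  define g where "g = (\<lambda>p. c k \<bullet> \<bar>fst p\<bar> + \<nu> * \<psi> (snd p))"
  define A where "A z = (lF z (x k), lT z (x k))" for z
  define v where "v = q k (y k - x k)"
  have A: "A ((1 - u) *\<^sub>R a + u *\<^sub>R b) = (1 - u) *\<^sub>R A a + u *\<^sub>R A b" for u a b
    unfolding A_def affine_lF affine_lT by simp
  have "convex_on UNIV g"
    unfolding g_def using \<nu>
    by (intro convex_on_add convex_on_cmul less_imp_le
        convex_on_compose_affine[OF convex_on_weighted_l1[OF c_nonneg]]
        convex_on_compose_affine[OF convex_\<psi>]) auto
  moreover have "convex_on (edom h) (\<lambda>z. lam * hr z + v \<bullet> z)"
    using lam convex_hr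
    by (intro convex_on_add convex_on_cmul convex_on_inner less_imp_le) (auto simp: convex_on_def)
  moreover have "g (A (y k)) + (lam * hr (y k) + v \<bullet> y k) \<le> g (A z) + (lam * hr z + v \<bullet> z)"
    if "z \<in> edom h" for z
    using variational_inequality[OF that, of k] unfolding g_def A_def v_def
    by (simp add: inner_diff_right)
  ultimately obtain w where w: "\<And>p. g (A (y k)) + w \<bullet> (p - A (y k)) \<le> g p"
    "\<And>z. z \<in> edom h \<Longrightarrow> lam * hr (y k) + v \<bullet> y k - w \<bullet> (A z - A (y k)) \<le> lam * hr z + v \<bullet> z"
    using composite_minimizer_subgradient[OF _ _ y_dom A] by blast
  show thesis
  proof (rule that)
    fix z
    show "c k \<bullet> \<bar>lF (y k) (x k)\<bar> + fst w \<bullet> (z - lF (y k) (x k)) \<le> c k \<bullet> \<bar>z\<bar>"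
      using w(1)[of "(z, lT (y k) (x k))"] by (simp add: g_def A_def inner_prod_def)
  next
    fix z
    show "\<nu> * \<psi> (lT (y k) (x k)) + snd w \<bullet> (z - lT (y k) (x k)) \<le> \<nu> * \<psi> z"
      using w(1)[of "(lF (y k) (x k), z)"] by (simp add: g_def A_def inner_prod_def)
  next
    fix z assume z: "z \<in> edom h"
    have "lF z (x k) - lF (y k) (x k) = F' (x k) (z - y k)" "lT z (x k) - lT (y k) (x k) = T' (x k) (z - y k)"
      by (simp_all add: blinfun.diff_right)
    then show "lam * hr (y k) - fst w \<bullet> F' (x k) (z - y k) - snd w \<bullet> T' (x k) (z - y k)
        - q k (y k - x k) \<bullet> (z - y k) \<le> lam * hr z"
      using w(2)[OF z] unfolding v_def[symmetric] by (simp add: A_def inner_prod_def inner_diff_right)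
  qed
qed

text \<open>Expanding the quadratic form around \<open>y k\<close> is exact; its linear part is
  absorbed by the variational inequality, and the remainder is bounded below through
  \<open>\<gamma>lo\<close>.\<close>

lemma strong_convexity:
  assumes z: "z \<in> edom h"
  shows "modelr k (y k) + \<gamma>lo / 2 * (norm (z - y k))\<^sup>2 \<le> modelr k z"
proof -
  have expand: "(u + v) \<bullet> q k (u + v) = u \<bullet> q k u + 2 * (q k u \<bullet> v) + v \<bullet> q k v" for u v
    using q(2)[of k u v] unfolding linear_add[OF q(1)]
    by (simp add: inner_add_left inner_add_right inner_commute[of v "q k u"])
  have "(z - x k) \<bullet> q k (z - x k) = (y k - x k) \<bullet> q k (y k - x k)
      + 2 * (q k (y k - x k) \<bullet> (z - y k)) + (z - y k) \<bullet> q k (z - y k)"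
    using expand[of "y k - x k" "z - y k"] by simp
  moreover have "\<gamma>lo / 2 * (norm (z - y k))\<^sup>2 \<le> 1/2 * ((z - y k) \<bullet> q k (z - y k))"
    using q(5)[of "z - y k" k] by simp
  ultimately show ?thesis using variational_inequality[OF z, of k] by argo
qed

lemma step_bounds:
  obtains C where "0 < C" "\<And>k. norm (y k - x k) \<le> C * sqrt (gap k)"
    "\<And>k. norm (x (Suc k) - x k) \<le> C * sqrt (gap k)"
proof -
  \<comment> \<open>Above the minimal model value, \<open>x (Suc k)\<close> lies by at most
    \<open>\<mu>max / 2 * gap k\<close> and \<open>x k\<close> by at most \<open>gap k\<close> more.
    Quadratic growth with modulus \<open>\<gamma>lo / 2\<close> turns the larger excess into a
    distance of at most \<open>a * sqrt (gap k)\<close> to \<open>y k\<close>.\<close>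
  define a where "a = sqrt (2 * (1 + \<mu>max / 2) / \<gamma>lo)"
  have \<mu>max: "0 < \<mu>max" using \<mu>[of 0] by simp
  then have a: "0 < a" using \<gamma>lo by (simp add: a_def)
  have le: "norm d \<le> a * sqrt (gap k)" if "\<gamma>lo / 2 * (norm d)\<^sup>2 \<le> (1 + \<mu>max / 2) * gap k" for d :: 'a and k
  proof (rule power2_le_imp_le)
    have "(norm d)\<^sup>2 \<le> 2 * (1 + \<mu>max / 2) / \<gamma>lo * gap k"
      using that \<gamma>lo by (simp add: field_simps)
    then show "(norm d)\<^sup>2 \<le> (a * sqrt (gap k))\<^sup>2"
      using \<mu>max \<gamma>lo gap_pos[of k] by (simp add: a_def power_mult_distrib)
  qed (use a gap_pos[of k] in \<open>simp add: less_imp_le\<close>)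
  have 1: "norm (y k - x k) \<le> a * sqrt (gap k)" for k
  proof (rule le)
    have "\<gamma>lo / 2 * (norm (x k - y k))\<^sup>2 \<le> gap k + \<mu>max / 2 * gap k"
      using strong_convexity[OF x_dom[of k], of k] inexact[of k] modelr_x[of k] gap_def[of k] by linarith
    then show "\<gamma>lo / 2 * (norm (y k - x k))\<^sup>2 \<le> (1 + \<mu>max / 2) * gap k"
      by (simp add: norm_minus_commute distrib_right)
  qed
  have 2: "norm (x (Suc k) - y k) \<le> a * sqrt (gap k)" for k
  proof (rule le)
    have "\<gamma>lo / 2 * (norm (x (Suc k) - y k))\<^sup>2 \<le> gap k + \<mu>max / 2 * gap k"
      using strong_convexity[OF x_dom[of "Suc k"], of k] inexact[of k] gap_pos[of k] by linarith
    then show "\<gamma>lo / 2 * (norm (x (Suc k) - y k))\<^sup>2 \<le> (1 + \<mu>max / 2) * gap k"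
      by (simp add: distrib_right)
  qed
  show thesis
  proof (rule that[of "2 * a"])
    show "norm (y k - x k) \<le> 2 * a * sqrt (gap k)" for k
      using order_trans[OF norm_ge_zero 1[of k]] 1[of k] by simp
    show "norm (x (Suc k) - x k) \<le> 2 * a * sqrt (gap k)" for k
      using 1[of k] 2[of k] norm_triangle_ineq[of "x (Suc k) - y k" "y k - x k"] by simp
  qed (use a in simp)
qed

section \<open>Convergence of the objective values and compactness of the iterates\<close>

lemma objr_bounded_below: obtains a where "\<And>z. z \<in> edom h \<Longrightarrow> a \<le> objr z - lam * hr z"
    "\<And>z. z \<in> edom h \<Longrightarrow> a \<le> objr z"
proof -
  obtain a b where a: "\<And>z. ereal a \<le> h z" and b: "\<And>z. b \<le> \<psi> z"
    using h_bounded_below \<psi>_bounded_below by metis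
  have 1: "\<nu> * b \<le> objr z - lam * hr z" for z
    using vartheta_nonneg[of "F z"] b[of "T z"] \<nu> by (simp add: add_increasing)
  have 2: "lam * a \<le> lam * hr z" if "z \<in> edom h" for z
    using a[of z] lam that by (simp add: h_dom)
  have 3: "min (lam * a) 0 \<le> 0" "min (lam * a) 0 \<le> lam * a" by auto
  show thesis
  proof (rule that)
    fix z assume z: "z \<in> edom h"
    show "\<nu> * b + min (lam * a) 0 \<le> objr z - lam * hr z" "\<nu> * b + min (lam * a) 0 \<le> objr z"
      using 1[of z] 2[OF z] 3 by linarith+
  qed
qed

lemma objr_decreasing: "objr (x (Suc k)) < objr (x k)"
  using descent[of k] gap_pos[of k] by simp

text \<open>Strictness matters: the derivative of a desingularizing function is available only at
  positive arguments. As every model decrease is positive, the limit value is never attained along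
  the run and needs no separate case.\<close>

lemma objr_limit: obtains l where "(\<lambda>k. objr (x k)) \<longlonglongrightarrow> l" "\<And>k. l < objr (x k)"
proof -
  obtain a where a: "\<And>z. z \<in> edom h \<Longrightarrow> a \<le> objr z" using objr_bounded_below by metis
  obtain l where l: "(\<lambda>k. objr (x k)) \<longlonglongrightarrow> l" "\<And>k. l \<le> objr (x k)"
    by (rule decseq_bounded_convergent[of "\<lambda>k. objr (x k)" a])
      (use a x_dom objr_decreasing in \<open>auto intro: less_imp_le\<close>)
  show thesis
    by (rule that[OF l(1)]) (use l(2) objr_decreasing order_le_less_trans in blast)
qed

lemma gap_tendsto_0: "gap \<longlonglongrightarrow> 0"
proof (rule tendsto_sandwich[of "\<lambda>_. 0" gap _ "\<lambda>k. objr (x k) - objr (x (Suc k))"])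
  obtain l where l: "(\<lambda>k. objr (x k)) \<longlonglongrightarrow> l" using objr_limit by blast
  then show "(\<lambda>k. objr (x k) - objr (x (Suc k))) \<longlonglongrightarrow> 0"
    using tendsto_diff[OF l LIMSEQ_Suc[OF l]] by simp
  show "\<forall>\<^sub>F k in sequentially. 0 \<le> gap k" using gap_pos by (simp add: less_imp_le)
  have "gap k \<le> objr (x k) - objr (x (Suc k))" for k using descent[of k] by simp
  then show "\<forall>\<^sub>F k in sequentially. gap k \<le> objr (x k) - objr (x (Suc k))" by simp
qed simp

lemma y_minus_x_tendsto_0: "(\<lambda>k. y k - x k) \<longlonglongrightarrow> 0"
proof -
  obtain C where C: "\<And>k. norm (y k - x k) \<le> C * sqrt (gap k)" using step_bounds by metis
  have "(\<lambda>k. C * sqrt (gap k)) \<longlonglongrightarrow> C * sqrt 0" by (intro tendsto_intros gap_tendsto_0)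
  moreover have "\<forall>\<^sub>F k in sequentially. norm (y k - x k) \<le> C * sqrt (gap k)" using C by simp
  ultimately show ?thesis using Lim_null_comparison by force
qed

text \<open>The domain of \<open>h\<close> need not be closed. But the objective decreases and its
  other terms are bounded below, so \<open>h\<close> is bounded above along the run, and the
  corresponding sublevel set is closed and contained in \<open>edom h\<close>.\<close>

lemma closure_range_x: "closure (range x) \<subseteq> edom h" "compact (closure (range x))"
proof -
  obtain a where a: "\<And>z. z \<in> edom h \<Longrightarrow> a \<le> objr z - lam * hr z" using objr_bounded_below by metis
  have "hr (x k) \<le> (objr (x 0) - a) / lam" for k
  proof -
    have "objr (x k) \<le> objr (x 0)"
      by (rule lift_Suc_antimono_le[of "\<lambda>k. objr (x k)"]) (use objr_decreasing less_imp_le in auto)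
    then show ?thesis using a[OF x_dom[of k]] lam by (simp add: field_simps)
  qed
  then have "range x \<subseteq> {z. h z \<le> ereal ((objr (x 0) - a) / lam)}"
    using x_dom by (auto simp: h_dom)
  then have "closure (range x) \<subseteq> {z. h z \<le> ereal ((objr (x 0) - a) / lam)}"
    by (rule closure_minimal) (rule closed_sublevel_lsc[OF lsc_h])
  then show "closure (range x) \<subseteq> edom h" by (auto simp: edom_def intro: order_le_less_trans)
  show "compact (closure (range x))" using bounded_x by (simp add: compact_closure)
qed

section \<open>Uniform bounds along the run\<close>

lemma continuous_on_U:
  "continuous_on U F" "continuous_on U T" "continuous_on U F'" "continuous_on U T'"
  using F' T' F'' T'' by (auto intro!: continuous_at_imp_continuous_on has_derivative_continuous)

lemma derivative_bounds:
  obtains M where "0 < M" "\<And>k. norm (F (x k)) \<le> M" "\<And>k. norm (T (x k)) \<le> M"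
    "\<And>k. norm (F' (x k)) \<le> M" "\<And>k. norm (T' (x k)) \<le> M"
    "\<And>k. norm (F'' (x k)) \<le> M" "\<And>k. norm (T'' (x k)) \<le> M"
proof -
  have K: "compact (closure (range x))" "closure (range x) \<subseteq> U"
    using closure_range_x dom_U by auto
  have x: "x k \<in> closure (range x)" for k by (rule subsetD[OF closure_subset]) simp
  obtain M1 where M1: "\<And>z. z \<in> closure (range x) \<Longrightarrow> norm (F z) \<le> M1"
    using continuous_image_bound[OF continuous_on_U(1) K] by blast
  obtain M2 where M2: "\<And>z. z \<in> closure (range x) \<Longrightarrow> norm (T z) \<le> M2"
    using continuous_image_bound[OF continuous_on_U(2) K] by blast
  obtain M3 where M3: "\<And>z. z \<in> closure (range x) \<Longrightarrow> norm (F' z) \<le> M3"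
    using continuous_image_bound[OF continuous_on_U(3) K] by blast
  obtain M4 where M4: "\<And>z. z \<in> closure (range x) \<Longrightarrow> norm (T' z) \<le> M4"
    using continuous_image_bound[OF continuous_on_U(4) K] by blast
  obtain M5 where M5: "\<And>z. z \<in> closure (range x) \<Longrightarrow> norm (F'' z) \<le> M5"
    using continuous_image_bound[OF F''(2) K] by blast
  obtain M6 where M6: "\<And>z. z \<in> closure (range x) \<Longrightarrow> norm (T'' z) \<le> M6"
    using continuous_image_bound[OF T''(2) K] by blast
  define M where "M = Max {1, M1, M2, M3, M4, M5, M6}"
  have le: "a \<le> M" if "a \<in> {1, M1, M2, M3, M4, M5, M6}" for a
    unfolding M_def using that by (intro Max_ge) simp_all
  show thesis
  proof (rule that)
    show "0 < M" using le[of 1] by simp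
    show "norm (F (x k)) \<le> M" "norm (T (x k)) \<le> M" "norm (F' (x k)) \<le> M" "norm (T' (x k)) \<le> M"
      "norm (F'' (x k)) \<le> M" "norm (T'' (x k)) \<le> M" for k
      by (rule order_trans[OF M1[OF x]] order_trans[OF M2[OF x]] order_trans[OF M3[OF x]]
          order_trans[OF M4[OF x]] order_trans[OF M5[OF x]] order_trans[OF M6[OF x]], rule le, simp)+
  qed
qed

lemma bounded_y_minus_x: obtains R where "\<And>k. norm (y k - x k) \<le> R"
  using convergent_imp_bounded[OF y_minus_x_tendsto_0] by (auto simp: bounded_iff)

lemma linearization_bounds:
  obtains M where "0 \<le> M" "\<And>k. norm (lF (y k) (x k)) \<le> M" "\<And>k. norm (lT (y k) (x k)) \<le> M"
proof -
  obtain M where M: "0 < M" "\<And>k. norm (F (x k)) \<le> M" "\<And>k. norm (T (x k)) \<le> M"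
    "\<And>k. norm (F' (x k)) \<le> M" "\<And>k. norm (T' (x k)) \<le> M" using derivative_bounds by metis
  obtain R where R: "\<And>k. norm (y k - x k) \<le> R" using bounded_y_minus_x by blast
  have F': "norm (F' (x k) (y k - x k)) \<le> M * R" and T': "norm (T' (x k) (y k - x k)) \<le> M * R" for k
    using M R[of k] by (auto intro!: order_trans[OF norm_blinfun] mult_mono simp: less_imp_le)
  show thesis
  proof (rule that[of "M + M * R"])
    show "norm (lF (y k) (x k)) \<le> M + M * R" "norm (lT (y k) (x k)) \<le> M + M * R" for k
      using norm_triangle_ineq[of "F (x k)" "F' (x k) (y k - x k)"] M(2)[of k] F'[of k]
        norm_triangle_ineq[of "T (x k)" "T' (x k) (y k - x k)"] M(3)[of k] T'[of k] by linarith+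
    show "0 \<le> M + M * R" using M(1) order_trans[OF norm_ge_zero R[of 0]] by simp
  qed
qed

text \<open>All absolute entries of \<open>F (x k)\<close> and of its linearisation at
  \<open>y k\<close> lie in one compact interval contained in \<open>I\<close>, where the local
  Lipschitz property of \<theta>' becomes uniform.\<close>

lemma \<theta>'_lipschitz_along:
  obtains L where "0 \<le> L"
    "\<And>k i j. \<bar>deriv \<theta> \<bar>lF (y k) (x k) $ i $ j\<bar> - deriv \<theta> \<bar>F (x k) $ i $ j\<bar>\<bar>
      \<le> L * \<bar>\<bar>lF (y k) (x k) $ i $ j\<bar> - \<bar>F (x k) $ i $ j\<bar>\<bar>"
proof -
  obtain M where M: "\<And>k. norm (F (x k)) \<le> M" using derivative_bounds by metis
  obtain N where N: "\<And>k. norm (lF (y k) (x k)) \<le> N" using linearization_bounds by metis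
  define R where "R = max M N"
  obtain L where L: "L-lipschitz_on {0..R} (deriv \<theta>)"
    by (rule lipschitz_on_compactI[OF \<theta>'_lipschitz, of "{0..R}"]) (use I_nonneg in auto)
  have R: "\<bar>F (x k) $ i $ j\<bar> \<in> {0..R}" "\<bar>lF (y k) (x k) $ i $ j\<bar> \<in> {0..R}" for k i j
    using order_trans[OF nth_nth_le_norm M[of k], of i j] order_trans[OF nth_nth_le_norm N[of k], of i j]
    by (auto simp: R_def)
  show thesis
    by (rule that[of L]) (use lipschitz_on_nonneg[OF L] lipschitz_onD[OF L R(2) R(1)] in
        \<open>auto simp: dist_real_def\<close>)
qed

subsection \<open>The potential function\<close>

abbreviation "\<gamma>hat \<equiv> 2 * \<rho> * \<gamma>tilde"
abbreviation "Xi' \<equiv> Xi h U F T \<psi> \<theta> \<nu> lam \<gamma>hat"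

definition "Xi_dom = {p :: 'a \<times> 'a \<times> real. fst p \<in> edom h \<and> fst (snd p) \<in> U \<and> 0 \<le> snd (snd p)}"

definition "Xir (p :: 'a \<times> 'a \<times> real) = vartheta \<theta> \<bar>lF (fst p) (fst (snd p))\<bar> + \<nu> * \<psi> (lT (fst p) (fst (snd p)))
  + lam * hr (fst p) + \<gamma>hat / 2 * (norm (fst p - fst (snd p)))\<^sup>2 + (snd (snd p))\<^sup>2"

lemma Xi_eq: "p \<in> Xi_dom \<Longrightarrow> Xi' p = ereal (Xir p)"
  by (cases p) (simp add: Xi_def Xir_def Xi_dom_def h_dom lin_at_F lin_at_T)

lemma Xi_not_dom: "p \<notin> Xi_dom \<Longrightarrow> Xi' p = \<infinity>"
  using lam by (cases p) (auto simp: Xi_def Xi_dom_def h_not_dom)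

lemma Xir_diagonal: "Xir (z, z, 0) = objr z"
  by (simp add: Xir_def)

text \<open>Concavity makes the linearisation an upper bound. In the other direction, the tangent at
  the new point instead of the old one leaves the error
  \<open>(\<theta>' b - \<theta>' a) (a - b)\<close> in each entry, which the Lipschitz bound makes
  quadratic.\<close>

lemma vartheta_linearization:
  fixes z w :: "real^'n^'m"
  assumes "\<And>i j. \<bar>deriv \<theta> \<bar>z $ i $ j\<bar> - deriv \<theta> \<bar>w $ i $ j\<bar>\<bar> \<le> L * \<bar>\<bar>z $ i $ j\<bar> - \<bar>w $ i $ j\<bar>\<bar>"
  shows "vartheta \<theta> \<bar>z\<bar> \<le> vartheta \<theta> \<bar>w\<bar> + grad_vartheta \<theta> \<bar>w\<bar> \<bullet> (\<bar>z\<bar> - \<bar>w\<bar>)" (is ?le)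
    and "0 \<le> L \<Longrightarrow> vartheta \<theta> \<bar>w\<bar> + grad_vartheta \<theta> \<bar>w\<bar> \<bullet> (\<bar>z\<bar> - \<bar>w\<bar>)
      \<le> vartheta \<theta> \<bar>z\<bar> + L * (norm (z - w))\<^sup>2" (is "_ \<Longrightarrow> ?ge")
proof -
  let ?a = "\<lambda>i j. \<bar>w $ i $ j\<bar>" and ?b = "\<lambda>i j. \<bar>z $ i $ j\<bar>"
  have eq: "vartheta \<theta> \<bar>w\<bar> + grad_vartheta \<theta> \<bar>w\<bar> \<bullet> (\<bar>z\<bar> - \<bar>w\<bar>)
      = (\<Sum>i\<in>UNIV. \<Sum>j\<in>UNIV. \<theta> (?a i j) + deriv \<theta> (?a i j) * (?b i j - ?a i j))"
    by (simp add: vartheta_def inner_matrix grad_vartheta_def abs_nth_nth sum.distrib)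
  show ?le
    unfolding eq unfolding vartheta_def abs_nth_nth by (intro sum_mono \<theta>_tangent) auto
  assume L: "0 \<le> L"
  have "\<theta> (?a i j) + deriv \<theta> (?a i j) * (?b i j - ?a i j) \<le> \<theta> (?b i j) + L * ((z - w) $ i $ j)\<^sup>2" for i j
  proof -
    define a b where "a = ?a i j" and "b = ?b i j"
    have "\<theta> a \<le> \<theta> b + deriv \<theta> b * (a - b)" by (rule \<theta>_tangent) (auto simp: a_def b_def)
    then have "\<theta> a + deriv \<theta> a * (b - a) \<le> \<theta> b + (deriv \<theta> b - deriv \<theta> a) * (a - b)"
      by (simp add: algebra_simps)
    also have "(deriv \<theta> b - deriv \<theta> a) * (a - b) \<le> \<bar>deriv \<theta> b - deriv \<theta> a\<bar> * \<bar>a - b\<bar>"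
      by (metis abs_ge_self abs_mult)
    also have "\<dots> \<le> (L * \<bar>b - a\<bar>) * \<bar>a - b\<bar>"
      using assms[of i j] by (intro mult_right_mono) (auto simp: a_def b_def)
    also have "\<dots> = L * \<bar>b - a\<bar>\<^sup>2" by (simp add: power2_eq_square abs_minus_commute)
    also have "\<dots> \<le> L * \<bar>(z - w) $ i $ j\<bar>\<^sup>2"
      using L by (intro mult_left_mono power_mono) (auto simp: a_def b_def intro: abs_triangle_ineq3)
    finally show ?thesis by (simp add: a_def b_def)
  qed
  then show ?ge
    unfolding eq unfolding vartheta_def sum_square_nth_nth[of "z - w", symmetric] sum_distrib_left abs_nth_nth
    by (simp add: sum_mono flip: sum.distrib)
qed

text \<open>The radius \<open>sqrt (B * gap k)\<close> of the third component absorbs both the inexactness and the error of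
  linearising \<open>\<theta>\<close>, which lifts the potential above the next objective value.\<close>

lemma Xir_bounds:
  obtains B C where "0 < B"
    "\<And>k. objr (x (Suc k)) \<le> Xir (y k, x k, sqrt (B * gap k))"
    "\<And>k. Xir (y k, x k, sqrt (B * gap k)) \<le> objr (x k) + C * gap k"
proof -
  obtain L where L: "0 \<le> L" "\<And>k i j. \<bar>deriv \<theta> \<bar>lF (y k) (x k) $ i $ j\<bar> - deriv \<theta> \<bar>F (x k) $ i $ j\<bar>\<bar>
      \<le> L * \<bar>\<bar>lF (y k) (x k) $ i $ j\<bar> - \<bar>F (x k) $ i $ j\<bar>\<bar>" using \<theta>'_lipschitz_along by blast
  obtain M where M: "0 < M" "\<And>k. norm (F' (x k)) \<le> M" using derivative_bounds by metis
  obtain D where D: "0 < D" "\<And>k. norm (y k - x k) \<le> D * sqrt (gap k)" using step_bounds by metis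
  \<comment> \<open>The first summand comes from the inexactness criterion. The second is the
    quadratic error of linearising \<theta>, since the linearised increment of \<open>F\<close> is
    at most \<open>M * D * sqrt (gap k)\<close>.\<close>
  define B where "B = \<mu>max / 2 + L * (M * D)\<^sup>2"
  have B_gap: "B * gap k = \<mu>max / 2 * gap k + L * (M * D)\<^sup>2 * gap k" for k
    by (simp add: B_def distrib_right)
  have "0 < \<mu>max" using \<mu>[of 0] by simp
  then have B: "0 < B" using L by (simp add: B_def add_pos_nonneg)
  have d2: "(norm (y k - x k))\<^sup>2 \<le> D\<^sup>2 * gap k" for k
    using power_mono[OF D(2), of k 2] gap_pos[of k] by (simp add: power_mult_distrib less_imp_le)
  have F'd: "L * (norm (F' (x k) (y k - x k)))\<^sup>2 \<le> L * (M * D)\<^sup>2 * gap k" for k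
  proof -
    have "norm (F' (x k) (y k - x k)) \<le> M * norm (y k - x k)"
      using M(2)[of k] by (intro order_trans[OF norm_blinfun] mult_right_mono) auto
    then have "(norm (F' (x k) (y k - x k)))\<^sup>2 \<le> (M * norm (y k - x k))\<^sup>2" by (intro power_mono) auto
    also have "\<dots> \<le> M\<^sup>2 * (D\<^sup>2 * gap k)"
      using d2[of k] by (simp add: power_mult_distrib mult_left_mono)
    finally show ?thesis using L(1) by (simp add: power_mult_distrib mult.assoc mult_left_mono)
  qed
  have Xir: "Xir (y k, x k, sqrt (B * gap k)) = vartheta \<theta> \<bar>lF (y k) (x k)\<bar> + \<nu> * \<psi> (lT (y k) (x k))
      + lam * hr (y k) + \<gamma>hat / 2 * (norm (y k - x k))\<^sup>2 + B * gap k" for k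
    using B gap_pos[of k] by (simp add: Xir_def less_imp_le)
  have modelr: "modelr k (y k) = vartheta \<theta> \<bar>F (x k)\<bar> + c k \<bullet> (\<bar>lF (y k) (x k)\<bar> - \<bar>F (x k)\<bar>)
      + \<nu> * \<psi> (lT (y k) (x k)) + lam * hr (y k) + 1/2 * ((y k - x k) \<bullet> q k (y k - x k))" for k
    by (simp add: inner_diff_right)
  note lin = vartheta_linearization[OF L(2)]
  have \<gamma>: "0 < \<rho> * \<gamma>tilde" using \<rho> \<gamma>tilde by simp
  show thesis
  proof (rule that[OF B])
    fix k
    have "objr (x (Suc k)) \<le> modelr k (y k) + \<mu>max / 2 * gap k"
      using descent[of k] inexact[of k] gap_def[of k] by linarith
    also have "\<dots> \<le> vartheta \<theta> \<bar>lF (y k) (x k)\<bar> + L * (M * D)\<^sup>2 * gap k + \<nu> * \<psi> (lT (y k) (x k))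
        + lam * hr (y k) + 1/2 * ((y k - x k) \<bullet> q k (y k - x k)) + \<mu>max / 2 * gap k"
      unfolding modelr using lin(2)[OF L(1), of k] F'd[of k] by simp
    \<comment> \<open>This is the role of \<open>\<gamma>hat\<close>: the fixed quadratic term of
      the potential dominates the varying proximal term of every accepted model.\<close>
    also have "1/2 * ((y k - x k) \<bullet> q k (y k - x k)) \<le> \<gamma>hat / 2 * (norm (y k - x k))\<^sup>2"
    proof -
      have "0 \<le> \<rho> * \<gamma>tilde * (norm (y k - x k))\<^sup>2" using \<gamma> by simp
      then show ?thesis using q(4)[of "y k - x k" k] by simp
    qed
    finally show "objr (x (Suc k)) \<le> Xir (y k, x k, sqrt (B * gap k))"
      using B_gap[of k] unfolding Xir by linarith
  next
    fix k
    have "vartheta \<theta> \<bar>lF (y k) (x k)\<bar> + \<nu> * \<psi> (lT (y k) (x k)) + lam * hr (y k) \<le> modelr k (y k)"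
      unfolding modelr using lin(1)[of k] q(3)[of "y k - x k" k] by linarith
    moreover have "modelr k (y k) \<le> objr (x k)"
      using y_min[OF x_dom[of k], of k] modelr_x[of k] by linarith
    moreover have "\<gamma>hat / 2 * (norm (y k - x k))\<^sup>2 \<le> \<gamma>hat / 2 * (D\<^sup>2 * gap k)"
      using d2[of k] \<gamma> by (intro mult_left_mono) auto
    moreover have "\<gamma>hat / 2 * (D\<^sup>2 * gap k) = \<gamma>hat / 2 * D\<^sup>2 * gap k" by simp
    ultimately show "Xir (y k, x k, sqrt (B * gap k)) \<le> objr (x k) + (\<gamma>hat / 2 * D\<^sup>2 + B) * gap k"
      unfolding Xir distrib_right by linarith
  qed
qed

section \<open>A small regular subgradient of the potential\<close>

lemma regular_subgradient_\<theta>_abs: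
  assumes \<sigma>: "\<sigma> \<in> abs_subdiff s"
  shows "regular_subgradient (\<lambda>r. \<theta> \<bar>r\<bar>) UNIV s (\<lambda>d. deriv \<theta> \<bar>s\<bar> * \<sigma> * d)"
  unfolding regular_subgradient_def
proof (intro allI impI)
  fix e :: real assume e: "0 < e"
  define t where "t = \<bar>s\<bar>"
  have "(\<theta> has_derivative (\<lambda>d. deriv \<theta> t * d)) (at t)"
    using \<theta>_diff[of t] unfolding t_def
    by (simp add: DERIV_deriv_iff_real_differentiable[symmetric] has_field_derivative_def)
  then have "\<forall>\<^sub>F r in at t. norm (\<theta> r - \<theta> t - deriv \<theta> t * (r - t)) \<le> e * norm (r - t)"
    using e unfolding has_derivative_within_alt2 by blast
  then have "\<forall>\<^sub>F r in nhds t. norm (\<theta> r - \<theta> t - deriv \<theta> t * (r - t)) \<le> e * norm (r - t)"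
    by (simp add: eventually_nhds_conv_at)
  moreover have "((\<lambda>r. \<bar>r\<bar>) \<longlongrightarrow> t) (at s)"
    unfolding t_def by (intro tendsto_intros)
  ultimately have "\<forall>\<^sub>F r in at s. norm (\<theta> \<bar>r\<bar> - \<theta> t - deriv \<theta> t * (\<bar>r\<bar> - t)) \<le> e * norm (\<bar>r\<bar> - t)"
    by (rule eventually_compose_filterlim)
  then show "\<forall>\<^sub>F r in at s. \<theta> \<bar>s\<bar> + deriv \<theta> \<bar>s\<bar> * \<sigma> * (r - s) - e * norm (r - s) \<le> \<theta> \<bar>r\<bar>"
  proof eventually_elim
    case (elim r)
    \<comment> \<open>Since \<theta>' is nonnegative, the subgradient inequality of the absolute
      value keeps its direction after multiplication; this covers the kink at 0 as well.\<close>
    have "deriv \<theta> t * (\<sigma> * (r - s)) \<le> deriv \<theta> t * (\<bar>r\<bar> - t)"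
      using \<sigma> \<theta>'_nonneg[of t] by (intro mult_left_mono) (auto simp: abs_subdiff_iff t_def algebra_simps)
    moreover have "e * \<bar>\<bar>r\<bar> - t\<bar> \<le> e * \<bar>r - s\<bar>"
      using e unfolding t_def by (intro mult_left_mono abs_triangle_ineq3) auto
    moreover have "\<theta> t + deriv \<theta> t * (\<bar>r\<bar> - t) - e * \<bar>\<bar>r\<bar> - t\<bar> \<le> \<theta> \<bar>r\<bar>"
      using elim unfolding real_norm_def abs_le_iff by linarith
    ultimately show ?case by (simp add: t_def mult.assoc)
  qed
qed

lemma regular_subgradient_vartheta_abs:
  fixes G :: "'b::real_normed_vector \<Rightarrow> real^'n^'m"
  assumes \<sigma>: "\<And>i j. \<sigma> i j \<in> abs_subdiff (G p $ i $ j)" and G: "(G has_derivative G') (at p within S)"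
  shows "regular_subgradient (\<lambda>p. vartheta \<theta> \<bar>G p\<bar>) S p
    (\<lambda>d. (\<chi> i j. deriv \<theta> \<bar>G p $ i $ j\<bar> * \<sigma> i j) \<bullet> G' d)"
proof -
  have "regular_subgradient (\<lambda>p. \<Sum>i\<in>UNIV. \<Sum>j\<in>UNIV. \<theta> \<bar>G p $ i $ j\<bar>) S p
      (\<lambda>d. \<Sum>i\<in>UNIV. \<Sum>j\<in>UNIV. deriv \<theta> \<bar>G p $ i $ j\<bar> * \<sigma> i j * G' d $ i $ j)"
  proof (intro regular_subgradient_sum finite)
    fix i j
    have "((\<lambda>p. G p $ i $ j) has_derivative (\<lambda>d. G' d $ i $ j)) (at p within S)"
      by (intro bounded_linear.has_derivative[OF bounded_linear_vec_nth] G)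
    from regular_subgradient_compose[OF regular_subgradient_\<theta>_abs[OF \<sigma>] bounded_linear_mult_right this]
    show "regular_subgradient (\<lambda>p. \<theta> \<bar>G p $ i $ j\<bar>) S p
      (\<lambda>d. deriv \<theta> \<bar>G p $ i $ j\<bar> * \<sigma> i j * G' d $ i $ j)" .
  qed
  then show ?thesis by (simp add: vartheta_def abs_nth_nth inner_matrix)
qed

text \<open>\<open>\<omega>\<close> carries the signs of \<open>w1\<close> with the weights seen by
  the potential. The \<open>h\<close> term contributes the subgradient given by optimality, so in
  the first component \<open>w2\<close> cancels and only \<open>\<omega> - w1\<close> remains
  besides the quadratic terms; the second component contains second derivatives applied to
  \<open>y k - x k\<close>. The coefficient 5 is 1 from \<open>q k\<close> plus 2 from
  \<open>\<gamma>hat\<close> in each of the first two components.\<close>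

lemma Xi_regular_subgradient:
  assumes w1: "\<And>i j. \<sigma> i j \<in> abs_subdiff (lF (y k) (x k) $ i $ j)"
      "\<And>i j. w1 $ i $ j = c k $ i $ j * \<sigma> i j"
    and w2: "\<And>z. \<nu> * \<psi> (lT (y k) (x k)) + w2 \<bullet> (z - lT (y k) (x k)) \<le> \<nu> * \<psi> z"
    and u: "\<And>z. z \<in> edom h \<Longrightarrow> lam * hr (y k) - w1 \<bullet> F' (x k) (z - y k) - w2 \<bullet> T' (x k) (z - y k)
        - q k (y k - x k) \<bullet> (z - y k) \<le> lam * hr z"
    and \<omega>: "\<omega> = (\<chi> i j. deriv \<theta> \<bar>lF (y k) (x k) $ i $ j\<bar> * \<sigma> i j)" and t: "0 \<le> t"
  obtains v where "v \<in> regular_subdiff Xi' (y k, x k, t)"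
    "norm v \<le> (norm (\<omega> - w1) * norm (F' (x k)) + norm \<omega> * (norm (F'' (x k)) * norm (y k - x k))
      + norm w2 * (norm (T'' (x k)) * norm (y k - x k)) + 5 * (\<rho> * \<gamma>tilde) * norm (y k - x k) + 2 * t)"
proof -
  define a b d where "a = y k" and "b = x k" and "d = y k - x k"
  let ?p = "(a, b, t)"
  define \<phi> where "\<phi> p = \<omega> \<bullet> (F' b (fst p) + F'' b (fst (snd p)) d)
      + w2 \<bullet> (T' b (fst p) + T'' b (fst (snd p)) d)
      + (- (w1 \<bullet> F' b (fst p)) - w2 \<bullet> T' b (fst p) - q k d \<bullet> fst p)
      + \<gamma>hat * (d \<bullet> (fst p - fst (snd p))) + 2 * t * snd (snd p)" for p :: "'a \<times> 'a \<times> real"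
  have p: "?p \<in> Xi_dom" using y_dom[of k] x_U[of k] t by (simp add: Xi_dom_def a_def b_def)
  have "regular_subgradient Xir Xi_dom ?p \<phi>"
    unfolding Xir_def[abs_def] \<phi>_def[abs_def]
  proof (intro regular_subgradient_add)
    have "((\<lambda>p. lF (fst p) (fst (snd p))) has_derivative (\<lambda>p. F' b (fst p) + F'' b (fst (snd p)) d))
        (at ?p within Xi_dom)"
      unfolding d_def a_def[symmetric] b_def[symmetric]
      by (rule linearization_has_derivative) (use F' F'' x_U b_def in auto)
    from regular_subgradient_vartheta_abs[where \<sigma> = \<sigma>, OF _ this] w1(1)
    show "regular_subgradient (\<lambda>p. vartheta \<theta> \<bar>lF (fst p) (fst (snd p))\<bar>) Xi_dom ?p
        (\<lambda>p. \<omega> \<bullet> (F' b (fst p) + F'' b (fst (snd p)) d))"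
      by (simp add: \<omega> a_def b_def)
    have dT: "((\<lambda>p. lT (fst p) (fst (snd p))) has_derivative (\<lambda>p. T' b (fst p) + T'' b (fst (snd p)) d))
        (at ?p within Xi_dom)"
      unfolding d_def a_def[symmetric] b_def[symmetric]
      by (rule linearization_has_derivative) (use T' T'' x_U b_def in auto)
    have "regular_subgradient (\<lambda>z. \<nu> * \<psi> z) UNIV (lT (fst ?p) (fst (snd ?p))) (\<lambda>z. w2 \<bullet> z)"
      by (rule regular_subgradient_affine_minorant) (use w2 in \<open>simp add: a_def b_def\<close>)
    from regular_subgradient_compose[OF this bounded_linear_inner_right dT]
    show "regular_subgradient (\<lambda>p. \<nu> * \<psi> (lT (fst p) (fst (snd p)))) Xi_dom ?p
        (\<lambda>p. w2 \<bullet> (T' b (fst p) + T'' b (fst (snd p)) d))" .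
    show "regular_subgradient (\<lambda>p. lam * hr (fst p)) Xi_dom ?p
        (\<lambda>p. - (w1 \<bullet> F' b (fst p)) - w2 \<bullet> T' b (fst p) - q k d \<bullet> fst p)"
      by (rule regular_subgradient_affine_minorant) (use u in \<open>auto simp: Xi_dom_def a_def b_def d_def algebra_simps\<close>)
    show "regular_subgradient (\<lambda>p. \<gamma>hat / 2 * (norm (fst p - fst (snd p)))\<^sup>2) Xi_dom ?p
        (\<lambda>p. \<gamma>hat * (d \<bullet> (fst p - fst (snd p))))"
    proof (rule regular_subgradient_has_derivative)
      have "((\<lambda>p. (fst p - fst (snd p)) \<bullet> (fst p - fst (snd p))) has_derivative
          (\<lambda>p. (a - b) \<bullet> (fst p - fst (snd p)) + (fst p - fst (snd p)) \<bullet> (a - b))) (at ?p within Xi_dom)"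
        by (auto intro!: derivative_eq_intros)
      from has_derivative_mult_right[OF this, of "\<gamma>hat / 2"]
      show "((\<lambda>p. \<gamma>hat / 2 * (norm (fst p - fst (snd p)))\<^sup>2) has_derivative
          (\<lambda>p. \<gamma>hat * (d \<bullet> (fst p - fst (snd p))))) (at ?p within Xi_dom)"
        by (simp add: power2_norm_eq_inner inner_commute mult.assoc mult.left_commute[of _ 2] d_def a_def b_def)
    qed
    show "regular_subgradient (\<lambda>p. (snd (snd p))\<^sup>2) Xi_dom ?p (\<lambda>p. 2 * t * snd (snd p))"
      by (rule regular_subgradient_has_derivative) (auto intro!: derivative_eq_intros)
  qed
  moreover have "linear \<phi>"
    by (rule linearI) (simp_all add: \<phi>_def blinfun.bilinear_simps inner_add_right inner_diff_right algebra_simps)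
  then obtain v where v: "\<phi> = (\<lambda>p. v \<bullet> p)" by (rule linear_functional_inner)
  ultimately have "v \<in> regular_subdiff Xi' ?p"
    by (intro regular_subdiffI[OF p Xi_eq Xi_not_dom]) auto
  moreover define N where "N = norm (\<omega> - w1) * norm (F' b) + norm \<omega> * (norm (F'' b) * norm d)
      + norm w2 * (norm (T'' b) * norm d) + 5 * (\<rho> * \<gamma>tilde) * norm d + 2 * t"
  \<comment> \<open>\<open>\<phi>\<close> is the pairing with \<open>v\<close>, so its value at
    \<open>v\<close> is the squared norm, and this one estimate bounds \<open>v\<close>.\<close>
  have "\<phi> v \<le> N * norm v"
  proof -
    define z w s n where "z = fst v" and "w = fst (snd v)" and "s = snd (snd v)" and "n = norm v"
    have n: "norm z \<le> n" "norm w \<le> n" "\<bar>s\<bar> \<le> n" "0 \<le> n"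
      using norm_fst_le[of z "(w, s)"] norm_snd_le[of "(w, s)" z] norm_fst_le[of w s] norm_snd_le[of s w]
      by (auto simp: z_def w_def s_def n_def)
    have "\<phi> v = (\<omega> - w1) \<bullet> F' b z + \<omega> \<bullet> F'' b w d + w2 \<bullet> T'' b w d - q k d \<bullet> z
        + \<gamma>hat * (d \<bullet> z) - \<gamma>hat * (d \<bullet> w) + 2 * t * s"
      unfolding \<phi>_def z_def[symmetric] w_def[symmetric] s_def[symmetric]
      by (simp add: inner_add_right inner_diff_left inner_diff_right right_diff_distrib)
    moreover have "(\<omega> - w1) \<bullet> F' b z \<le> norm (\<omega> - w1) * (norm (F' b) * n)"
      by (rule order_trans[OF norm_cauchy_schwarz], rule mult_left_mono,
          rule order_trans[OF norm_blinfun]) (use n in \<open>auto intro: mult_left_mono\<close>)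
    moreover have "\<omega> \<bullet> F'' b w d \<le> norm \<omega> * (norm (F'' b) * n * norm d)"
      by (rule order_trans[OF norm_cauchy_schwarz], rule mult_left_mono,
          rule order_trans[OF norm_blinfun], rule mult_right_mono, rule order_trans[OF norm_blinfun])
        (use n in \<open>auto intro: mult_left_mono\<close>)
    moreover have "w2 \<bullet> T'' b w d \<le> norm w2 * (norm (T'' b) * n * norm d)"
      by (rule order_trans[OF norm_cauchy_schwarz], rule mult_left_mono,
          rule order_trans[OF norm_blinfun], rule mult_right_mono, rule order_trans[OF norm_blinfun])
        (use n in \<open>auto intro: mult_left_mono\<close>)
    moreover have "- (q k d \<bullet> z) \<le> \<rho> * \<gamma>tilde * norm d * n"
    proof -
      have "- (q k d \<bullet> z) \<le> norm (q k d) * norm z"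
        using norm_cauchy_schwarz[of "- q k d" z] by simp
      also have "\<dots> \<le> (\<rho> * \<gamma>tilde * norm d) * n"
        using n norm_q[of k d] by (intro mult_mono) (auto intro: order_trans[OF norm_ge_zero])
      finally show ?thesis .
    qed
    moreover have "\<gamma>hat * (e \<bullet> r) \<le> \<gamma>hat * (norm e * n)" if "norm r \<le> n" for e r :: 'a
      using \<rho> \<gamma>tilde that
      by (intro mult_left_mono order_trans[OF norm_cauchy_schwarz]) auto
    from this[OF n(1), of d] this[OF n(2), of "- d"]
    have "\<gamma>hat * (d \<bullet> z) \<le> \<gamma>hat * (norm d * n)" "- (\<gamma>hat * (d \<bullet> w)) \<le> \<gamma>hat * (norm d * n)"
      by simp_all
    moreover have "2 * t * s \<le> 2 * t * n" using t n by (intro mult_left_mono) auto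
    ultimately show ?thesis
      unfolding N_def n_def[symmetric] by (simp add: algebra_simps)
  qed
  then have "norm v \<le> N"
  proof (cases "v = 0")
    case True
    have "0 \<le> N" using t \<rho> \<gamma>tilde by (simp add: N_def)
    then show ?thesis using True by simp
  next
    case False
    have "\<phi> v = norm v * norm v" unfolding v by (simp add: power2_norm_eq_inner[symmetric] power2_eq_square)
    then show ?thesis using \<open>\<phi> v \<le> N * norm v\<close> False by simp
  qed
  ultimately show thesis
    by (intro that[of v]) (simp_all add: N_def a_def b_def d_def)
qed

text \<open>Entries of \<open>w1\<close> are bounded by the weights, hence by \<theta>' at 0 because
  \<theta>' is decreasing. For \<open>w2\<close> the linearisation points stay in a ball, on which
  subgradients of a finite convex function are bounded.\<close>

lemma subgradients_along_bounded:
  obtains C where "0 \<le> C"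
    and "\<And>k w1. (\<And>z. c k \<bullet> \<bar>lF (y k) (x k)\<bar> + w1 \<bullet> (z - lF (y k) (x k)) \<le> c k \<bullet> \<bar>z\<bar>) \<Longrightarrow> norm w1 \<le> C"
    and "\<And>k w2. (\<And>z. \<nu> * \<psi> (lT (y k) (x k)) + w2 \<bullet> (z - lT (y k) (x k)) \<le> \<nu> * \<psi> z) \<Longrightarrow> norm w2 \<le> C"
proof -
  obtain N where N: "\<And>k. norm (lT (y k) (x k)) \<le> N" using linearization_bounds by metis
  have "convex_on UNIV (\<lambda>z. \<nu> * \<psi> z)" using \<nu> by (intro convex_on_cmul convex_\<psi>) simp
  then obtain P where P: "\<And>y w. y \<in> cball 0 N \<Longrightarrow> (\<And>z. \<nu> * \<psi> y + w \<bullet> (z - y) \<le> \<nu> * \<psi> z) \<Longrightarrow> norm w \<le> P"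
    using subgradients_bounded[OF _ bounded_cball] by blast
  define W where "W = norm (\<chi> (i::'m) (j::'n). deriv \<theta> 0)"
  show thesis
  proof (rule that[of "max W P"])
    show "0 \<le> max W P" by (simp add: W_def le_max_iff_disj)
  next
    fix k w2 assume "\<And>z. \<nu> * \<psi> (lT (y k) (x k)) + w2 \<bullet> (z - lT (y k) (x k)) \<le> \<nu> * \<psi> z"
    then have "norm w2 \<le> P" using N[of k] by (intro P) auto
    then show "norm w2 \<le> max W P" by simp
  next
    fix k w1 assume w1: "\<And>z. c k \<bullet> \<bar>lF (y k) (x k)\<bar> + w1 \<bullet> (z - lF (y k) (x k)) \<le> c k \<bullet> \<bar>z\<bar>"
    obtain \<sigma> where \<sigma>: "\<And>i j. \<sigma> i j \<in> abs_subdiff (lF (y k) (x k) $ i $ j)" "\<And>i j. w1 $ i $ j = c k $ i $ j * \<sigma> i j"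
      using subgradient_weighted_l1[OF c_nonneg w1] by blast
    have "norm w1 \<le> 1 * norm (\<chi> (i::'m) (j::'n). deriv \<theta> 0)"
    proof (rule norm_le_entrywise)
      fix i j
      have "\<bar>w1 $ i $ j\<bar> \<le> c k $ i $ j"
        using abs_subdiff_bounded[OF \<sigma>(1)] c_nonneg[of k i j] by (simp add: \<sigma>(2) abs_mult mult_left_le)
      also have "\<dots> \<le> deriv \<theta> 0" by (simp add: c_nth \<theta>'_antimono)
      finally show "\<bar>w1 $ i $ j\<bar> \<le> 1 * \<bar>(\<chi> (i::'m) (j::'n). deriv \<theta> 0) $ i $ j\<bar>" by simp
    qed simp
    then show "norm w1 \<le> max W P" by (simp add: W_def)
  qed
qed

lemma Xi_subgradient_bound:
  assumes B: "0 < B"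
  obtains C where "0 < C" "\<And>k. \<exists>v\<in>regular_subdiff Xi' (y k, x k, sqrt (B * gap k)). norm v \<le> C * sqrt (gap k)"
proof -
  obtain L where L: "0 \<le> L" "\<And>k i j. \<bar>deriv \<theta> \<bar>lF (y k) (x k) $ i $ j\<bar> - deriv \<theta> \<bar>F (x k) $ i $ j\<bar>\<bar>
      \<le> L * \<bar>\<bar>lF (y k) (x k) $ i $ j\<bar> - \<bar>F (x k) $ i $ j\<bar>\<bar>" using \<theta>'_lipschitz_along by blast
  obtain M where M: "0 < M" "\<And>k. norm (F' (x k)) \<le> M" "\<And>k. norm (F'' (x k)) \<le> M"
    "\<And>k. norm (T'' (x k)) \<le> M" using derivative_bounds by metis
  obtain D where D: "0 < D" "\<And>k. norm (y k - x k) \<le> D * sqrt (gap k)" using step_bounds by metis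
  obtain P where P: "0 \<le> P" "\<And>k w2. (\<And>z. \<nu> * \<psi> (lT (y k) (x k)) + w2 \<bullet> (z - lT (y k) (x k)) \<le> \<nu> * \<psi> z)
      \<Longrightarrow> norm w2 \<le> P"
    by (rule subgradients_along_bounded) blast
  define W where "W = norm (\<chi> (i::'m) (j::'n). deriv \<theta> 0)"
  \<comment> \<open>In order: the weight mismatch mapped by the adjoint of \<open>F'\<close>, the
    second-derivative terms of \<open>F\<close> and \<open>T\<close>, and the quadratic
    terms.\<close>
  define E where "E = L * M * M + W * M + P * M + 5 * (\<rho> * \<gamma>tilde)"
  have E: "0 \<le> E" using L M P \<rho> \<gamma>tilde by (simp add: E_def W_def)
  show thesis
  proof (rule that[of "E * D + 2 * sqrt B"])
    show "0 < E * D + 2 * sqrt B" using E D B by (simp add: add_nonneg_pos)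
  next
    fix k
    let ?l = "lF (y k) (x k)" and ?d = "norm (y k - x k)"
    obtain w1 w2 where w1: "\<And>z. c k \<bullet> \<bar>?l\<bar> + w1 \<bullet> (z - ?l) \<le> c k \<bullet> \<bar>z\<bar>"
      and w2: "\<And>z. \<nu> * \<psi> (lT (y k) (x k)) + w2 \<bullet> (z - lT (y k) (x k)) \<le> \<nu> * \<psi> z"
      and u: "\<And>z. z \<in> edom h \<Longrightarrow> lam * hr (y k) - w1 \<bullet> F' (x k) (z - y k) - w2 \<bullet> T' (x k) (z - y k)
        - q k (y k - x k) \<bullet> (z - y k) \<le> lam * hr z"
      using optimality[of k] by blast
    obtain \<sigma> where \<sigma>: "\<And>i j. \<sigma> i j \<in> abs_subdiff (?l $ i $ j)" "\<And>i j. w1 $ i $ j = c k $ i $ j * \<sigma> i j"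
      using subgradient_weighted_l1[OF c_nonneg w1] by blast
    have \<sigma>1: "\<bar>\<sigma> i j\<bar> \<le> 1" for i j using \<sigma>(1) by (rule abs_subdiff_bounded)
    define \<omega> where "\<omega> = (\<chi> i j. deriv \<theta> \<bar>?l $ i $ j\<bar> * \<sigma> i j)"
    \<comment> \<open>With common signs, each entry of the difference is a difference of values of
      \<theta>' times a factor of modulus at most 1.\<close>
    have "norm (\<omega> - w1) \<le> L * norm (?l - F (x k))"
    proof (rule norm_le_entrywise[OF _ L(1)])
      fix i j
      have "\<bar>(\<omega> - w1) $ i $ j\<bar> = \<bar>deriv \<theta> \<bar>?l $ i $ j\<bar> - deriv \<theta> \<bar>F (x k) $ i $ j\<bar>\<bar> * \<bar>\<sigma> i j\<bar>"
        by (simp add: \<omega>_def \<sigma>(2) c_nth abs_mult flip: left_diff_distrib)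
      also have "\<dots> \<le> \<bar>deriv \<theta> \<bar>?l $ i $ j\<bar> - deriv \<theta> \<bar>F (x k) $ i $ j\<bar>\<bar> * 1"
        by (intro mult_left_mono \<sigma>1) simp
      also have "\<dots> \<le> L * \<bar>\<bar>?l $ i $ j\<bar> - \<bar>F (x k) $ i $ j\<bar>\<bar>" using L(2) by simp
      also have "\<dots> \<le> L * \<bar>(?l - F (x k)) $ i $ j\<bar>"
        using L(1) abs_triangle_ineq3[of "?l $ i $ j" "F (x k) $ i $ j"] by (intro mult_left_mono) auto
      finally show "\<bar>(\<omega> - w1) $ i $ j\<bar> \<le> L * \<bar>(?l - F (x k)) $ i $ j\<bar>" .
    qed
    also have "\<dots> \<le> L * (M * ?d)"
      using L(1) M(2)[of k] by (auto intro!: mult_left_mono order_trans[OF norm_blinfun] mult_right_mono)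
    finally have 1: "norm (\<omega> - w1) \<le> L * (M * ?d)" .
    have 2: "norm \<omega> \<le> W"
    proof -
      have "norm \<omega> \<le> 1 * norm (\<chi> (i::'m) (j::'n). deriv \<theta> 0)"
      proof (rule norm_le_entrywise)
        fix i j
        have "\<bar>\<omega> $ i $ j\<bar> \<le> \<bar>deriv \<theta> \<bar>?l $ i $ j\<bar>\<bar> * 1"
          unfolding \<omega>_def by (simp add: abs_mult \<sigma>1 mult_left_le)
        also have "\<dots> \<le> deriv \<theta> 0"
          using \<theta>'_antimono[of 0 "\<bar>?l $ i $ j\<bar>"] \<theta>'_nonneg[of "\<bar>?l $ i $ j\<bar>"] by simp
        finally show "\<bar>\<omega> $ i $ j\<bar> \<le> 1 * \<bar>(\<chi> (i::'m) (j::'n). deriv \<theta> 0) $ i $ j\<bar>" by simp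
      qed simp
      then show ?thesis by (simp add: W_def)
    qed
    have 3: "norm w2 \<le> P" using w2 by (rule P(2))
    obtain v where v: "v \<in> regular_subdiff Xi' (y k, x k, sqrt (B * gap k))"
      "norm v \<le> (norm (\<omega> - w1) * norm (F' (x k)) + norm \<omega> * (norm (F'' (x k)) * ?d)
      + norm w2 * (norm (T'' (x k)) * ?d) + 5 * (\<rho> * \<gamma>tilde) * ?d + 2 * sqrt (B * gap k))"
      by (rule Xi_regular_subgradient[OF \<sigma> w2 u \<omega>_def, of "sqrt (B * gap k)"])
        (use B gap_pos[of k] in \<open>auto simp: less_imp_le\<close>)
    have "norm v \<le> (L * (M * ?d)) * M + W * (M * ?d) + P * (M * ?d) + 5 * (\<rho> * \<gamma>tilde) * ?d
        + 2 * sqrt (B * gap k)"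
      using 1 2 3 M L(1) P(1)
      by (intro order_trans[OF v(2)] add_mono mult_mono mult_nonneg_nonneg order_refl)
        (auto simp: less_imp_le W_def)
    also have "\<dots> = E * ?d + 2 * sqrt B * sqrt (gap k)"
      by (simp add: E_def real_sqrt_mult algebra_simps)
    also have "\<dots> \<le> E * (D * sqrt (gap k)) + 2 * sqrt B * sqrt (gap k)"
      using E D(2)[of k] by (intro add_right_mono mult_left_mono)
    also have "\<dots> = (E * D + 2 * sqrt B) * sqrt (gap k)" by (simp add: algebra_simps)
    finally show "\<exists>v\<in>regular_subdiff Xi' (y k, x k, sqrt (B * gap k)). norm v \<le> (E * D + 2 * sqrt B) * sqrt (gap k)"
      using v(1) by blast
  qed
qed

subsection \<open>Finite length and stationarity\<close>

lemma continuous_on_\<theta>': "continuous_on I (deriv \<theta>)"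
  by (rule locally_lipschitz_on_imp_continuous_on[OF \<theta>'_lipschitz])

lemma continuous_on_hr: "continuous_on (edom h) hr"
  by (rule locally_lipschitz_on_imp_continuous_on[OF hr_lipschitz])

lemma continuous_on_\<psi>: "continuous_on UNIV \<psi>"
  by (rule convex_on_continuous[OF open_UNIV convex_\<psi>])

lemma continuous_on_objr: "continuous_on (edom h) (\<lambda>z. objr z)"
proof -
  have \<theta>: "continuous_on {0..} \<theta>"
    by (intro continuous_at_imp_continuous_on ballI differentiable_imp_continuous_within \<theta>_diff) auto
  have FT: "continuous_on (edom h) F" "continuous_on (edom h) T"
    using continuous_on_U dom_U by (auto intro: continuous_on_subset)
  have "continuous_on (edom h) (\<lambda>z. \<theta> \<bar>F z $ i $ j\<bar>)" for i j
  proof (rule continuous_on_compose2[OF \<theta>])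
    show "continuous_on (edom h) (\<lambda>z. \<bar>F z $ i $ j\<bar>)" by (intro continuous_intros FT)
  qed auto
  moreover have "continuous_on (edom h) (\<lambda>z. \<psi> (T z))"
    by (rule continuous_on_compose2[OF continuous_on_\<psi> FT(2)]) simp
  ultimately show ?thesis
    unfolding vartheta_def abs_nth_nth
    by (intro continuous_on_add continuous_on_mult continuous_on_const continuous_on_sum continuous_on_hr)
qed

text \<open>Continuity of \<open>h\<close> relative to its domain gives convergence of the values,
  where lower semicontinuity alone would give one inequality.\<close>

lemma cluster_point:
  assumes s: "strict_mono s" "(x \<circ> s) \<longlonglongrightarrow> xs"
  shows "xs \<in> edom h" "(\<lambda>i. objr (x (s i))) \<longlonglongrightarrow> objr xs"
proof -
  have "xs \<in> closure (range x)"
    unfolding closure_sequential using s by (intro exI[of _ "x \<circ> s"]) auto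
  then show xs: "xs \<in> edom h" using closure_range_x by blast
  show "(\<lambda>i. objr (x (s i))) \<longlonglongrightarrow> objr xs"
    using s(2) x_dom by (intro continuous_on_tendsto_compose[OF continuous_on_objr _ xs]) (auto simp: o_def)
qed

lemma finite_length:
  assumes KL: "KL_function Xi'"
  shows "summable (\<lambda>k. norm (x (Suc k) - x k))"
proof -
  obtain B C where B: "0 < B" and lo: "\<And>k. objr (x (Suc k)) \<le> Xir (y k, x k, sqrt (B * gap k))"
    and hi: "\<And>k. Xir (y k, x k, sqrt (B * gap k)) \<le> objr (x k) + C * gap k"
    using Xir_bounds by blast
  define p where "p k = (y k, x k, sqrt (B * gap k))" for k
  obtain C1 where C1: "0 < C1" "\<And>k. \<exists>v\<in>regular_subdiff Xi' (p k). norm v \<le> C1 * sqrt (gap k)"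
    using Xi_subgradient_bound[OF B] unfolding p_def by blast
  then obtain v where v: "\<And>k. v k \<in> regular_subdiff Xi' (p k)" "\<And>k. norm (v k) \<le> C1 * sqrt (gap k)"
    by metis
  obtain D where D: "0 < D" "\<And>k. norm (x (Suc k) - x k) \<le> D * sqrt (gap k)" using step_bounds by metis
  obtain l where l: "(\<lambda>k. objr (x k)) \<longlonglongrightarrow> l" "\<And>k. l < objr (x k)" using objr_limit by blast
  obtain xs s where s: "strict_mono s" "(x \<circ> s) \<longlonglongrightarrow> xs"
    using bounded_imp_convergent_subsequence[OF bounded_x] by blast
  have xs: "xs \<in> edom h" "objr xs = l"
    using cluster_point[OF s] LIMSEQ_subseq_LIMSEQ[OF l(1) s(1)] by (auto simp: o_def intro: LIMSEQ_unique)
  have p: "p k \<in> Xi_dom" for k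
    using y_dom x_U B gap_pos[of k] by (simp add: p_def Xi_dom_def less_imp_le)
  have p0: "(xs, xs, 0) \<in> Xi_dom" using xs dom_U by (simp add: Xi_dom_def)
  have sqrt0: "(\<lambda>k. a * sqrt (b * gap k)) \<longlonglongrightarrow> 0" for a b
  proof -
    have "(\<lambda>k. a * sqrt (b * gap k)) \<longlonglongrightarrow> a * sqrt (b * 0)"
      by (intro tendsto_mult tendsto_const tendsto_real_sqrt gap_tendsto_0)
    then show ?thesis by simp
  qed
  have Xir_l: "(\<lambda>k. Xir (p k)) \<longlonglongrightarrow> l"
  proof (rule tendsto_sandwich)
    show "(\<lambda>k. objr (x (Suc k))) \<longlonglongrightarrow> l" using l(1) by (rule LIMSEQ_Suc)
    show "(\<lambda>k. objr (x k) + C * gap k) \<longlonglongrightarrow> l"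
      using tendsto_add[OF l(1) tendsto_mult[OF tendsto_const[of C] gap_tendsto_0]] by simp
  qed (use lo hi in \<open>simp_all add: p_def\<close>)
  \<comment> \<open>\<open>KL_function\<close> speaks only about points with nonempty limiting
    subdifferential. Membership is witnessed by the subgradients \<open>v k\<close>, which tend to
    0; the required convergence of the potential values is \<open>Xir_l\<close>.\<close>
  have "0 \<in> limiting_subdiff Xi' (xs, xs, 0)"
    unfolding limiting_subdiff_def
  proof (intro CollectI conjI exI)
    show "\<bar>Xi' (xs, xs, 0)\<bar> \<noteq> \<infinity>" using Xi_eq[OF p0] by simp
    have xs': "(\<lambda>i. x (s i)) \<longlonglongrightarrow> xs" using s(2) by (simp add: o_def)
    have "(\<lambda>i. y (s i) - x (s i) + x (s i)) \<longlonglongrightarrow> 0 + xs"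
      using LIMSEQ_subseq_LIMSEQ[OF y_minus_x_tendsto_0 s(1)] xs' by (intro tendsto_add) (simp_all add: o_def)
    then show "(p \<circ> s) \<longlonglongrightarrow> (xs, xs, 0)"
      using xs' LIMSEQ_subseq_LIMSEQ[OF sqrt0[of 1 B] s(1)]
      unfolding p_def o_def by (intro tendsto_Pair) simp_all
    show "(\<lambda>i. Xi' ((p \<circ> s) i)) \<longlonglongrightarrow> Xi' (xs, xs, 0)"
      using LIMSEQ_subseq_LIMSEQ[OF Xir_l s(1)] xs(2) Xi_eq[OF p] Xi_eq[OF p0]
      by (simp add: Xir_diagonal o_def)
    show "\<forall>i. (v \<circ> s) i \<in> regular_subdiff Xi' ((p \<circ> s) i)" using v by simp
    have "v \<longlonglongrightarrow> 0"
    proof (rule Lim_null_comparison)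
      show "(\<lambda>k. C1 * sqrt (gap k)) \<longlonglongrightarrow> 0" using sqrt0[of C1 1] by simp
    qed (use v in simp)
    then show "(v \<circ> s) \<longlonglongrightarrow> 0" by (rule LIMSEQ_subseq_LIMSEQ[OF _ s(1)])
  qed
  then have "KL_property_at Xi' (xs, xs, 0)" using KL unfolding KL_function_def by blast
  moreover have Xi0: "Xi' (xs, xs, 0) = ereal l" using Xi_eq[OF p0] xs(2) by (simp add: Xir_diagonal)
  ultimately obtain \<eta> \<phi> V where \<eta>: "0 < \<eta>" and \<phi>: "\<phi> \<in> Upsilon \<eta>" and V: "open V" "(xs, xs, 0) \<in> V"
    and KL_V: "\<And>p. \<lbrakk>p \<in> V; ereal l < Xi' p; Xi' p < ereal l + \<eta>\<rbrakk> \<Longrightarrow>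
      1 \<le> ereal (deriv \<phi> (real_of_ereal (Xi' p - ereal l))) * dist_zero_subdiff Xi' p"
    unfolding KL_property_at_def by metis
  obtain e where e: "0 < e" "ball (xs, xs, 0) e \<subseteq> V" using V by (meson open_contains_ball)
  have small: "\<forall>\<^sub>F k in sequentially. ereal (a k - l) < \<eta>" if "a \<longlonglongrightarrow> l" for a :: "nat \<Rightarrow> real"
  proof -
    have "(\<lambda>k. ereal (a k - l)) \<longlonglongrightarrow> ereal 0" using tendsto_diff[OF that tendsto_const[of l]] by simp
    from order_tendstoD(2)[OF this, of \<eta>] \<eta> show ?thesis by (simp add: zero_ereal_def)
  qed
  \<comment> \<open>The distance of \<open>p k\<close> to \<open>(xs, xs, 0)\<close> is at most
    \<open>norm (y k - x k)\<close>, twice \<open>norm (x k - xs)\<close> and the third component: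
    four quarters of \<open>e\<close>.\<close>
  have "\<forall>\<^sub>F k in sequentially. norm (y k - x k) < e / 4"
    using tendstoD[OF y_minus_x_tendsto_0, of "e / 4"] e(1) by simp
  moreover have "\<forall>\<^sub>F k in sequentially. sqrt (B * gap k) < e / 4"
    using order_tendstoD(2)[OF sqrt0[of 1 B], of "e / 4"] e(1) by simp
  ultimately have "\<forall>\<^sub>F k in sequentially. norm (y k - x k) < e / 4 \<and> sqrt (B * gap k) < e / 4
      \<and> ereal (objr (x k) - l) < \<eta> \<and> ereal (Xir (p k) - l) < \<eta>"
    using small[OF l(1)] small[OF Xir_l] by eventually_elim simp
  then obtain K0 where K0: "\<And>k. k \<ge> K0 \<Longrightarrow> norm (y k - x k) < e / 4 \<and> sqrt (B * gap k) < e / 4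
      \<and> ereal (objr (x k) - l) < \<eta> \<and> ereal (Xir (p k) - l) < \<eta>"
    by (auto simp: eventually_sequentially)
  have "summable (\<lambda>k. sqrt (gap k))"
  proof (rule KL_finite_length[OF \<phi> \<eta>, where D = "\<lambda>k. objr (x k) - l" and c = D and \<delta> = "e / 4"
        and C = C1 and m = K0, OF _ _ _ _ _ D(2) _ s])
    show "(\<lambda>k. objr (x k) - l) \<longlonglongrightarrow> 0" using tendsto_diff[OF l(1) tendsto_const[of l]] by simp
    show "0 < objr (x k) - l" for k using l(2)[of k] by simp
    show "ereal (objr (x k) - l) < \<eta>" if "k \<ge> K0" for k using K0[OF that] by blast
    show "0 \<le> sqrt (gap k)" for k using gap_pos[of k] by simp
    show "(sqrt (gap k))\<^sup>2 \<le> objr (x k) - l - (objr (x (Suc k)) - l)" for k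
      using descent[of k] gap_pos[of k] by simp
    show "1 \<le> C1 * deriv \<phi> (objr (x (Suc k)) - l) * sqrt (gap k)"
      if k: "k \<ge> K0" "norm (x k - xs) < e / 4" for k
    proof -
      \<comment> \<open>The KL inequality yields the slope at \<open>E\<close>. As \<open>E\<close>
        is at least the next objective gap, which is positive, the slope there is at least as large;
        this explains the index \<open>Suc k\<close>.\<close>
      define E where "E = Xir (p k) - l"
      have E: "objr (x (Suc k)) - l \<le> E" "ereal E < \<eta>"
        using lo[of k] K0[OF k(1)] by (auto simp: E_def p_def)
      have E0: "0 < E" using l(2)[of "Suc k"] E(1) by simp
      have "norm (p k - (xs, xs, 0)) \<le> norm (y k - xs) + (norm (x k - xs) + norm (sqrt (B * gap k)))"
        using norm_Pair_le[of "y k - xs" "(x k - xs, sqrt (B * gap k))"]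
          norm_Pair_le[of "x k - xs" "sqrt (B * gap k)"]
        by (simp add: p_def)
      also have "norm (y k - xs) \<le> norm (y k - x k) + norm (x k - xs)"
        using norm_triangle_ineq[of "y k - x k" "x k - xs"] by simp
      finally have "norm (p k - (xs, xs, 0)) < e"
        using K0[OF k(1)] k(2) B gap_pos[of k] by simp
      then have pV: "p k \<in> V" using e(2) by (auto simp: dist_norm norm_minus_commute)
      have "1 \<le> ereal (deriv \<phi> E) * dist_zero_subdiff Xi' (p k)"
        using KL_V[OF pV] E0 E(2) Xi_eq[OF p[of k]] by (cases \<eta>) (auto simp: E_def)
      also have "\<dots> \<le> ereal (deriv \<phi> E) * ereal (C1 * sqrt (gap k))"
      proof (rule ereal_mult_left_mono)
        have "dist_zero_subdiff Xi' (p k) \<le> ereal (norm (v k))"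
          unfolding dist_zero_subdiff_def
          using v(1) regular_subdiff_subset_limiting by (intro INF_lower) blast
        then show "dist_zero_subdiff Xi' (p k) \<le> ereal (C1 * sqrt (gap k))"
          using v(2)[of k] by (meson ereal_less_eq(3) order_trans)
        show "0 \<le> ereal (deriv \<phi> E)" using \<phi> E0 E(2) by (auto simp: Upsilon_def less_imp_le)
      qed
      finally have "1 \<le> deriv \<phi> E * (C1 * sqrt (gap k))" by (simp add: one_ereal_def)
      also have "\<dots> \<le> deriv \<phi> (objr (x (Suc k)) - l) * (C1 * sqrt (gap k))"
        using E l(2)[of "Suc k"] C1(1) gap_pos[of k]
        by (intro mult_right_mono Upsilon_deriv_antimono[OF \<phi>]) (auto simp: less_imp_le)
      finally show ?thesis by (simp add: algebra_simps)
    qed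
  qed (use e C1 D in auto)
  then have "summable (\<lambda>k. D * sqrt (gap k))" by (rule summable_mult)
  then show ?thesis by (rule summable_comparison_test') (use D(2) in simp)
qed

text \<open>Global affine minorants are regular and hence limiting subgradients. The vector
  \<open>u\<close> is obtained by solving the stationarity equation, and the third inequality says
  that it is a subgradient of \<open>h\<close>; \<open>w2\<close> is divided by \<open>\<nu>\<close>
  since it belongs to \<open>\<nu> * \<psi>\<close>.\<close>

lemma stationary_pointI:
  assumes z0: "z0 \<in> edom h"
    and w1: "\<And>z. grad_vartheta \<theta> \<bar>F z0\<bar> \<bullet> \<bar>F z0\<bar> + w1 \<bullet> (z - F z0) \<le> grad_vartheta \<theta> \<bar>F z0\<bar> \<bullet> \<bar>z\<bar>"
    and w2: "\<And>z. \<nu> * \<psi> (T z0) + w2 \<bullet> (z - T z0) \<le> \<nu> * \<psi> z"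
    and u: "\<And>z. z \<in> edom h \<Longrightarrow> lam * hr z0 - w1 \<bullet> F' z0 (z - z0) - w2 \<bullet> T' z0 (z - z0) \<le> lam * hr z"
  shows "z0 \<in> stationary_points h F T \<psi> \<theta> \<nu> lam"
proof -
  let ?A = "adjoint (frechet_derivative F (at z0))" and ?B = "adjoint (frechet_derivative T (at z0))"
  have fd: "frechet_derivative F (at z0) = F' z0" "frechet_derivative T (at z0) = T' z0"
    using frechet_derivative_at[OF F'] frechet_derivative_at[OF T'] dom_U[OF z0] by auto
  have lin: "linear (blinfun_apply (F' z0))" "linear (blinfun_apply (T' z0))"
    by (simp_all add: blinfun.bounded_linear_right bounded_linear.linear)
  have A: "?A w \<bullet> z = w \<bullet> F' z0 z" and B: "?B r \<bullet> z = r \<bullet> T' z0 z" for w r z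
    unfolding fd using adjoint_works[OF lin(1)] adjoint_works[OF lin(2)] by (metis inner_commute)+
  define u where "u = (- 1 / lam) *\<^sub>R (?A w1 + ?B w2)"
  have "0 \<le> grad_vartheta \<theta> \<bar>F z0\<bar> $ i $ j" for i j
    by (simp add: grad_vartheta_def abs_nth_nth \<theta>'_nonneg)
  then obtain \<sigma> where "\<And>i j. \<sigma> i j \<in> abs_subdiff (F z0 $ i $ j)"
    "\<And>i j. w1 $ i $ j = grad_vartheta \<theta> \<bar>F z0\<bar> $ i $ j * \<sigma> i j"
    using subgradient_weighted_l1[OF _ w1] by blast
  then have 1: "w1 \<in> circ_abs_subdiff (grad_vartheta \<theta> \<bar>F z0\<bar>) (F z0)"
    unfolding circ_abs_subdiff_def by (intro CollectI allI) (auto intro!: imageI)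
  have "(1 / \<nu>) *\<^sub>R w2 \<in> regular_subdiff (\<lambda>y. ereal (\<psi> y)) (T z0)"
  proof (rule regular_subdiffI[where D = UNIV and g = \<psi>])
    show "regular_subgradient \<psi> UNIV (T z0) (\<lambda>d. (1 / \<nu>) *\<^sub>R w2 \<bullet> d)"
      by (rule regular_subgradient_affine_minorant) (use w2 \<nu> in \<open>simp add: field_simps\<close>)
  qed auto
  then have 2: "(1 / \<nu>) *\<^sub>R w2 \<in> limiting_subdiff (\<lambda>y. ereal (\<psi> y)) (T z0)"
    using regular_subdiff_subset_limiting by blast
  have "u \<in> regular_subdiff h z0"
  proof (rule regular_subdiffI[OF z0 h_dom h_not_dom])
    show "regular_subgradient hr (edom h) z0 (\<lambda>d. u \<bullet> d)"
    proof (rule regular_subgradient_affine_minorant)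
      fix z assume "z \<in> edom h"
      from u[OF this] have "lam * (hr z0 + u \<bullet> (z - z0)) \<le> lam * hr z"
        using lam unfolding u_def inner_scaleR_left inner_add_left A B by (simp add: distrib_left right_diff_distrib)
      then show "hr z0 + u \<bullet> (z - z0) \<le> hr z" using lam by simp
    qed
  qed auto
  then have 3: "u \<in> limiting_subdiff h z0" using regular_subdiff_subset_limiting by blast
  have "?B ((1 / \<nu>) *\<^sub>R w2) = (1 / \<nu>) *\<^sub>R ?B w2"
    unfolding fd by (rule linear_cmul[OF adjoint_linear[OF lin(2)]])
  then have "0 = ?A w1 + \<nu> *\<^sub>R ?B ((1 / \<nu>) *\<^sub>R w2) + lam *\<^sub>R u"
    using \<nu> lam by (simp add: u_def)
  with 1 2 3 z0 show ?thesis unfolding stationary_points_def by blast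
qed

text \<open>For each fixed test point the optimality inequalities pass to the limit, so closedness
  of subdifferentials never has to be invoked; the multipliers converge along a subsequence because
  they are bounded.\<close>

lemma limit_stationary:
  assumes x: "x \<longlonglongrightarrow> xs"
  shows "xs \<in> stationary_points h F T \<psi> \<theta> \<nu> lam"
proof -
  have xs: "xs \<in> edom h" using cluster_point[of id xs] x by (simp add: strict_mono_def)
  then have U: "xs \<in> U" by (rule dom_U)
  have cont: "(\<lambda>k. G (x k)) \<longlonglongrightarrow> G xs" if "continuous_on U G" for G :: "'a \<Rightarrow> 'b::topological_space"
    using continuous_on_tendsto_compose[OF that x U] x_U by simp
  note limF = cont[OF continuous_on_U(1)] cont[OF continuous_on_U(3)]
  note limT = cont[OF continuous_on_U(2)] cont[OF continuous_on_U(4)]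
  have y: "y \<longlonglongrightarrow> xs" using tendsto_add[OF y_minus_x_tendsto_0 x] by simp
  have lF: "(\<lambda>k. lF (y k) (x k)) \<longlonglongrightarrow> F xs"
    using tendsto_add[OF limF(1) blinfun.tendsto[OF limF(2) y_minus_x_tendsto_0]] by simp
  have lT: "(\<lambda>k. lT (y k) (x k)) \<longlonglongrightarrow> T xs"
    using tendsto_add[OF limT(1) blinfun.tendsto[OF limT(2) y_minus_x_tendsto_0]] by simp
  have c: "c \<longlonglongrightarrow> grad_vartheta \<theta> \<bar>F xs\<bar>"
    unfolding grad_vartheta_def abs_nth_nth
    by (intro tendsto_vec_lambda continuous_on_tendsto_compose[OF continuous_on_\<theta>'] tendsto_rabs
        tendsto_vec_nth limF always_eventually allI) (use I_nonneg in auto)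
  have qd: "(\<lambda>k. q k (y k - x k)) \<longlonglongrightarrow> 0"
  proof (rule Lim_null_comparison)
    have "(\<lambda>k. \<rho> * \<gamma>tilde * norm (y k - x k)) \<longlonglongrightarrow> \<rho> * \<gamma>tilde * norm (0 :: 'a)"
      by (intro tendsto_mult tendsto_const tendsto_norm y_minus_x_tendsto_0)
    then show "(\<lambda>k. \<rho> * \<gamma>tilde * norm (y k - x k)) \<longlonglongrightarrow> 0" by simp
  qed (use norm_q in simp)
  obtain w1 w2 where w1: "\<And>k z. c k \<bullet> \<bar>lF (y k) (x k)\<bar> + w1 k \<bullet> (z - lF (y k) (x k)) \<le> c k \<bullet> \<bar>z\<bar>"
    and w2: "\<And>k z. \<nu> * \<psi> (lT (y k) (x k)) + w2 k \<bullet> (z - lT (y k) (x k)) \<le> \<nu> * \<psi> z"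
    and u: "\<And>k z. z \<in> edom h \<Longrightarrow> lam * hr (y k) - w1 k \<bullet> F' (x k) (z - y k) - w2 k \<bullet> T' (x k) (z - y k)
        - q k (y k - x k) \<bullet> (z - y k) \<le> lam * hr z"
  proof -
    have "\<exists>w. (\<forall>z. c k \<bullet> \<bar>lF (y k) (x k)\<bar> + fst w \<bullet> (z - lF (y k) (x k)) \<le> c k \<bullet> \<bar>z\<bar>)
      \<and> (\<forall>z. \<nu> * \<psi> (lT (y k) (x k)) + snd w \<bullet> (z - lT (y k) (x k)) \<le> \<nu> * \<psi> z)
      \<and> (\<forall>z\<in>edom h. lam * hr (y k) - fst w \<bullet> F' (x k) (z - y k) - snd w \<bullet> T' (x k) (z - y k)
        - q k (y k - x k) \<bullet> (z - y k) \<le> lam * hr z)" for k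
    proof (rule optimality[of k], goal_cases)
      case (1 w1 w2)
      then show ?case by (intro exI[of _ "(w1, w2)"]) auto
    qed
    then obtain w where "\<And>k. (\<forall>z. c k \<bullet> \<bar>lF (y k) (x k)\<bar> + fst (w k) \<bullet> (z - lF (y k) (x k)) \<le> c k \<bullet> \<bar>z\<bar>)
      \<and> (\<forall>z. \<nu> * \<psi> (lT (y k) (x k)) + snd (w k) \<bullet> (z - lT (y k) (x k)) \<le> \<nu> * \<psi> z)
      \<and> (\<forall>z\<in>edom h. lam * hr (y k) - fst (w k) \<bullet> F' (x k) (z - y k) - snd (w k) \<bullet> T' (x k) (z - y k)
        - q k (y k - x k) \<bullet> (z - y k) \<le> lam * hr z)"
      by meson
    then show thesis by (intro that[of "\<lambda>k. fst (w k)" "\<lambda>k. snd (w k)"]) blast+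
  qed
  obtain C where C: "\<And>k. norm (w1 k) \<le> C" "\<And>k. norm (w2 k) \<le> C"
    by (rule subgradients_along_bounded) (use w1 w2 in blast)
  \<comment> \<open>Bounding the pair yields one subsequence for both multipliers.\<close>
  have "norm (w1 k, w2 k) \<le> C + C" for k
    by (rule order_trans[OF norm_Pair_le add_mono[OF C]])
  then have "bounded (range (\<lambda>k. (w1 k, w2 k)))" unfolding bounded_iff by blast
  then obtain w r where r: "strict_mono r" and wr: "((\<lambda>k. (w1 k, w2 k)) \<circ> r) \<longlonglongrightarrow> w"
    using bounded_imp_convergent_subsequence by blast
  have w: "(\<lambda>i. w1 (r i)) \<longlonglongrightarrow> fst w" "(\<lambda>i. w2 (r i)) \<longlonglongrightarrow> snd w"
    using tendsto_fst[OF wr] tendsto_snd[OF wr] by (simp_all add: o_def)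
  have sub: "(\<lambda>i. a (r i)) \<longlonglongrightarrow> l" if "a \<longlonglongrightarrow> l" for a :: "nat \<Rightarrow> 'b::topological_space" and l
    using LIMSEQ_subseq_LIMSEQ[OF that r] by (simp add: o_def)
  note lims = sub[OF lF] sub[OF lT] sub[OF c] sub[OF qd] sub[OF y] sub[OF limF(2)] sub[OF limT(2)]
  have psi: "(\<lambda>i. \<psi> (lT (y (r i)) (x (r i)))) \<longlonglongrightarrow> \<psi> (T xs)"
    using continuous_on_tendsto_compose[OF continuous_on_\<psi> lims(2)] by simp
  have hr: "(\<lambda>i. hr (y (r i))) \<longlonglongrightarrow> hr xs"
    using continuous_on_tendsto_compose[OF continuous_on_hr lims(5) xs] y_dom by simp
  show ?thesis
  proof (rule stationary_pointI[OF xs, of "fst w" "snd w"])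
    fix z
    show "grad_vartheta \<theta> \<bar>F xs\<bar> \<bullet> \<bar>F xs\<bar> + fst w \<bullet> (z - F xs) \<le> grad_vartheta \<theta> \<bar>F xs\<bar> \<bullet> \<bar>z\<bar>"
    proof (rule LIMSEQ_le)
      show "(\<lambda>i. c (r i) \<bullet> \<bar>lF (y (r i)) (x (r i))\<bar> + w1 (r i) \<bullet> (z - lF (y (r i)) (x (r i))))
          \<longlonglongrightarrow> grad_vartheta \<theta> \<bar>F xs\<bar> \<bullet> \<bar>F xs\<bar> + fst w \<bullet> (z - F xs)"
        by (intro tendsto_add tendsto_inner tendsto_diff tendsto_const tendsto_abs_matrix lims w)
      show "(\<lambda>i. c (r i) \<bullet> \<bar>z\<bar>) \<longlonglongrightarrow> grad_vartheta \<theta> \<bar>F xs\<bar> \<bullet> \<bar>z\<bar>"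
        by (intro tendsto_inner tendsto_const lims)
    qed (use w1 in blast)
  next
    fix z
    show "\<nu> * \<psi> (T xs) + snd w \<bullet> (z - T xs) \<le> \<nu> * \<psi> z"
    proof (rule LIMSEQ_le_const2)
      show "(\<lambda>i. \<nu> * \<psi> (lT (y (r i)) (x (r i))) + w2 (r i) \<bullet> (z - lT (y (r i)) (x (r i))))
          \<longlonglongrightarrow> \<nu> * \<psi> (T xs) + snd w \<bullet> (z - T xs)"
        by (intro tendsto_add tendsto_mult tendsto_inner tendsto_diff tendsto_const lims w psi)
    qed (use w2 in blast)
  next
    fix z assume z: "z \<in> edom h"
    have "lam * hr xs - fst w \<bullet> F' xs (z - xs) - snd w \<bullet> T' xs (z - xs) - 0 \<bullet> (z - xs) \<le> lam * hr z"
    proof (rule LIMSEQ_le_const2)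
      show "(\<lambda>i. lam * hr (y (r i)) - w1 (r i) \<bullet> F' (x (r i)) (z - y (r i))
          - w2 (r i) \<bullet> T' (x (r i)) (z - y (r i)) - q (r i) (y (r i) - x (r i)) \<bullet> (z - y (r i)))
          \<longlonglongrightarrow> lam * hr xs - fst w \<bullet> F' xs (z - xs) - snd w \<bullet> T' xs (z - xs) - 0 \<bullet> (z - xs)"
        by (intro tendsto_diff tendsto_mult tendsto_inner blinfun.tendsto tendsto_const lims w hr)
    qed (use u[OF z] in blast)
    then show "lam * hr xs - fst w \<bullet> F' xs (z - xs) - snd w \<bullet> T' xs (z - xs) \<le> lam * hr z" by simp
  qed
qed

end

theorem theorem4p6:
  fixes h :: "'a::euclidean_space \<Rightarrow> ereal"
    and U :: "'a set"
    and F :: "'a \<Rightarrow> real^'n^'m"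
    and T :: "'a \<Rightarrow> real^'q^'p"
    and \<psi> :: "real^'q^'p \<Rightarrow> real"
    and I :: "real set"
    and \<theta> :: "real \<Rightarrow> real"
    and \<nu> lam \<rho> \<gamma>lo \<gamma>hi \<mu>max \<gamma>tilde :: real
    and \<mu> :: "nat \<Rightarrow> real"
    and x :: "nat \<Rightarrow> 'a"
    and \<gamma> :: "nat \<Rightarrow> nat \<Rightarrow> real"
    and Q :: "nat \<Rightarrow> nat \<Rightarrow> 'a \<Rightarrow> 'a"
    and xin xb :: "nat \<Rightarrow> nat \<Rightarrow> 'a"
    and jj :: "nat \<Rightarrow> nat"
  assumes "standing_assumption h U F T \<psi> I \<theta>"
    and "0 < \<nu>" and "0 < lam"
    and "iPMM_run h F T \<psi> \<theta> \<nu> lam \<rho> \<gamma>lo \<gamma>hi \<mu>max \<mu> x \<gamma> Q xin xb jj"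
    and "bounded (range x)"
    and "C2_on U F" and "C2_on U T"
    and "0 < \<gamma>tilde" and "\<forall>k. \<gamma> k (jj k) \<le> \<gamma>tilde"
    and "KL_function (Xi h U F T \<psi> \<theta> \<nu> lam (2 * \<rho> * \<gamma>tilde))"
  shows "summable (\<lambda>k. norm (x (k + 2) - x (k + 1))) \<and>
         (\<exists>xs. x \<longlonglongrightarrow> xs \<and> xs \<in> stationary_points h F T \<psi> \<theta> \<nu> lam)"
proof -
  obtain F' F'' where F: "\<And>z. z \<in> U \<Longrightarrow> (F has_derivative blinfun_apply (F' z)) (at z)"
    "\<And>z. z \<in> U \<Longrightarrow> (F' has_derivative blinfun_apply (F'' z)) (at z)" "continuous_on U F''"
    using \<open>C2_on U F\<close> unfolding C2_on_def by blast
  obtain T' T'' where T: "\<And>z. z \<in> U \<Longrightarrow> (T has_derivative blinfun_apply (T' z)) (at z)"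
    "\<And>z. z \<in> U \<Longrightarrow> (T' has_derivative blinfun_apply (T'' z)) (at z)" "continuous_on U T''"
    using \<open>C2_on U T\<close> unfolding C2_on_def by blast
  interpret iPMM_C2 h U F T \<psi> I \<theta> \<nu> lam \<rho> \<gamma>lo \<gamma>hi \<mu>max \<gamma>tilde \<mu> x \<gamma> Q xin xb jj F' F'' T' T''
    by unfold_locales (use assms F T in auto)
  have sum: "summable (\<lambda>k. norm (x (Suc k) - x k))" using assms(10) by (rule finite_length)
  then obtain xs where "x \<longlonglongrightarrow> xs"
    using summable_steps_convergent unfolding convergent_def by blast
  \<comment> \<open>The series in the claim begins with the step from \<open>x 1\<close> to
    \<open>x 2\<close>, hence the shift by one.\<close>
  moreover have "summable (\<lambda>k. norm (x (k + 2) - x (k + 1)))"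
    using sum summable_Suc_iff[of "\<lambda>k. norm (x (Suc k) - x k)"] by simp
  ultimately show ?thesis using limit_stationary by blast
qed

end
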